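(* Let $q\in\mathbb C$. The following conditions are equivalent: (i) the reflection function $D(\infty)\ni\sigma\mapsto q^{\ell_{\mathcal R}(\sigma)}$ is positive definite on $D(\infty)$; (ii) the reflection function $D(\infty)\ni\sigma\mapsto q^{\ell_{\mathcal R}(\sigma)}$ is a character of $D(\infty)$; (iii) the reflection function $D(\infty)\ni\sigma\mapsto q^{\ell_{\mathcal R}(\sigma)}$ is an extreme character of $D(\infty)$; (iv) the reflection function $D(\infty)\ni\sigma\mapsto q^{\ell_{\mathcal R}(\sigma)}$ is the restriction of the positive definite reflection function $B(\infty)\ni\sigma\mapsto q^{\ell_{\mathcal R}(\sigma)}$ on $B(\infty)$ (in particular the latter is positive definite on $B(\infty)$); (v) $q\in\{\frac{1}{2N+1}\colon N\in\mathbb Z\}\cup\{0\}$.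
   Context: Let $[\pm n]=\{-n,\dots,-1,1,\dots,n\}$, $\overline i=-i$. $B(n)$ is the group of permutations $\sigma$ of $[\pm n]$ with $\sigma(\overline i)=\overline{\sigma(i)}$; equivalently $B(n)=\mathbb Z_2\wr\mathfrak S_n$ with elements $(g_1,\dots,g_n;\sigma)$, $g_i=\pm1$. $D(n)$ is the index-two normal subgroup of $B(n)$ of elements with $g_1\cdots g_n=1$ (equivalently, an even number of $i\in\{1,\dots,n\}$ with $\sigma(i)<0$). $B(\infty)=\bigcup_nB(n)$ and $D(\infty)=\bigcup_nD(n)$, via the embeddings in which $B(n-1)\subset B(n)$ fixes $\pm n$. The set of reflections $\mathcal R$ of $B(n)$ is $\{(i\,j)(\overline i\,\overline j)\colon i,j\in[\pm n],|i|\ne|j|\}\cup\{(i\,\overline i)\colon1\le i\le n\}$; the set of reflections $\mathcal R$ of $D(n)$ is $\{(i\,j)(\overline i\,\overline j)\colon i,j\in[\pm n],|i|\neq|j|\}$. In each group the reflection length $\ell_{\mathcal R}(\sigma)$ is the minimal $k$ such that $\sigma$ is a product of $k$ reflections of that group (compatible with the embeddings). Convention: $0^0=1$. A function $\phi\colon G\to\mathbb C$ is positive definite if $\sum_{i,j=1}^kz_i\overline{z_j}\,\phi(g_j^{-1}g_i)\ge0$ for all $k\ge1$, $z_i\in\mathbb C$, $g_i\in G$. A character of $G$ is a conjugation-invariant positive definite function with value $1$ at the identity; an extreme character is an extreme point of the convex set of characters. *)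

theory Defs
  imports Complex_Main "HOL-Library.Nonpos_Ints" "HOL-Combinatorics.Permutations" "HOL-Algebra.Group"
begin

definition signed_range :: "nat \<Rightarrow> int set"
  where "signed_range n = {- int n..int n} - {0}"

text \<open>
  A signed permutation is a function on all of \<open>int\<close> that is the identity outside
  \<open>signed_range n\<close>. The embedding of \<open>B_perms (n - 1)\<close> into \<open>B_perms n\<close> is thus an inclusion.
\<close>

definition B_perms :: "nat \<Rightarrow> (int \<Rightarrow> int) set"
  where "B_perms n = {\<sigma>. \<sigma> permutes signed_range n \<and> (\<forall>i\<in>signed_range n. \<sigma> (- i) = - \<sigma> i)}"

definition D_perms :: "nat \<Rightarrow> (int \<Rightarrow> int) set"
  where "D_perms n = {\<sigma> \<in> B_perms n. even (card {i \<in> {1..int n}. \<sigma> i < 0})}"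

definition B_inf :: "(int \<Rightarrow> int) monoid"
  where "B_inf = \<lparr>carrier = (\<Union>n. B_perms n), mult = (\<circ>), one = id\<rparr>"

definition D_inf :: "(int \<Rightarrow> int) monoid"
  where "D_inf = \<lparr>carrier = (\<Union>n. D_perms n), mult = (\<circ>), one = id\<rparr>"

definition D_refl :: "nat \<Rightarrow> (int \<Rightarrow> int) set"
  where "D_refl n = {transpose i j \<circ> transpose (- i) (- j) | i j.
    i \<in> signed_range n \<and> j \<in> signed_range n \<and> \<bar>i\<bar> \<noteq> \<bar>j\<bar>}"

definition B_refl :: "nat \<Rightarrow> (int \<Rightarrow> int) set"
  where "B_refl n = D_refl n \<union> {transpose i (- i) | i. 1 \<le> i \<and> i \<le> int n}"

definition word_length :: "('a, 'b) monoid_scheme \<Rightarrow> 'a set \<Rightarrow> 'a \<Rightarrow> nat"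
  where "word_length G R g =
    (LEAST k. \<exists>rs. length rs = k \<and> set rs \<subseteq> R \<and> foldr (mult G) rs \<one>\<^bsub>G\<^esub> = g)"

definition B_length :: "(int \<Rightarrow> int) \<Rightarrow> nat"
  where "B_length = word_length B_inf (\<Union>n. B_refl n)"

definition D_length :: "(int \<Rightarrow> int) \<Rightarrow> nat"
  where "D_length = word_length D_inf (\<Union>n. D_refl n)"

text \<open>
  Functions on \<open>G\<close> are total functions whose values outside \<open>carrier G\<close> are irrelevant;
  equality of functions on \<open>G\<close> therefore means equality on \<open>carrier G\<close>.
\<close>

definition positive_definite :: "('a, 'b) monoid_scheme \<Rightarrow> ('a \<Rightarrow> complex) \<Rightarrow> bool"
  where "positive_definite G \<phi> \<longleftrightarrow>
    (\<forall>k\<ge>1. \<forall>z :: nat \<Rightarrow> complex. \<forall>g. (\<forall>i\<in>{1..k}. g i \<in> carrier G) \<longrightarrow>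
      (\<Sum>i=1..k. \<Sum>j=1..k. z i * cnj (z j) * \<phi> (inv\<^bsub>G\<^esub> g j \<otimes>\<^bsub>G\<^esub> g i)) \<in> \<real>\<^sub>\<ge>\<^sub>0)"

definition group_character :: "('a, 'b) monoid_scheme \<Rightarrow> ('a \<Rightarrow> complex) \<Rightarrow> bool"
  where "group_character G \<phi> \<longleftrightarrow>
    positive_definite G \<phi> \<and>
    (\<forall>g\<in>carrier G. \<forall>h\<in>carrier G. \<phi> (h \<otimes>\<^bsub>G\<^esub> g \<otimes>\<^bsub>G\<^esub> inv\<^bsub>G\<^esub> h) = \<phi> g) \<and>
    \<phi> \<one>\<^bsub>G\<^esub> = 1"

definition extreme_character :: "('a, 'b) monoid_scheme \<Rightarrow> ('a \<Rightarrow> complex) \<Rightarrow> bool"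
  where "extreme_character G \<phi> \<longleftrightarrow>
    group_character G \<phi> \<and>
    (\<forall>\<chi> \<psi>. \<forall>t::real. group_character G \<chi> \<longrightarrow> group_character G \<psi> \<longrightarrow> 0 < t \<longrightarrow> t < 1 \<longrightarrow>
      (\<forall>g\<in>carrier G. \<phi> g = of_real (1 - t) * \<chi> g + of_real t * \<psi> g) \<longrightarrow>
      (\<forall>g\<in>carrier G. \<chi> g = \<psi> g))"

lemma B_perms_iff:
  "\<sigma> \<in> B_perms n \<longleftrightarrow> \<sigma> permutes signed_range n \<and> (\<forall>i. \<sigma> (- i) = - \<sigma> i)"
proof -
  have "\<sigma> (- i) = - \<sigma> i" if "\<sigma> permutes signed_range n" "i \<notin> signed_range n" for i
  proof -
    have "- i \<notin> signed_range n" using that(2) by (auto simp: signed_range_def)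
    then show ?thesis using that by (simp add: permutes_def)
  qed
  then show ?thesis by (auto simp: B_perms_def)
qed

lemma B_perms_mono: "m \<le> n \<Longrightarrow> B_perms m \<subseteq> B_perms n"
  by (auto simp: B_perms_iff signed_range_def elim!: permutes_subset)

lemma B_perms_comp: "\<sigma> \<in> B_perms n \<Longrightarrow> \<tau> \<in> B_perms n \<Longrightarrow> \<sigma> \<circ> \<tau> \<in> B_perms n"
  by (auto simp: B_perms_iff intro: permutes_compose)

lemma B_perms_inv:
  assumes "\<sigma> \<in> B_perms n" shows "inv_into UNIV \<sigma> \<in> B_perms n"
proof -
  have p: "\<sigma> permutes signed_range n" and o: "\<And>i. \<sigma> (- i) = - \<sigma> i"
    using assms by (auto simp: B_perms_iff)
  have "inv_into UNIV \<sigma> (- i) = - inv_into UNIV \<sigma> i" for i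
    by (metis p o permutes_inverses)
  then show ?thesis using p by (auto simp: B_perms_iff permutes_inv)
qed

lemma id_in_B_perms: "id \<in> B_perms n"
  by (auto simp: B_perms_iff permutes_id)

lemma D_perms_iff: "\<sigma> \<in> D_perms n \<longleftrightarrow> \<sigma> \<in> B_perms n \<and> (\<Prod>i=1..int n. sgn (\<sigma> i)) = 1"
proof -
  have "(\<Prod>i=1..int n. sgn (\<sigma> i)) = (- 1) ^ card {i \<in> {1..int n}. \<sigma> i < 0}" if "\<sigma> \<in> B_perms n"
  proof -
    have p: "\<sigma> permutes signed_range n" using that by (simp add: B_perms_def)
    have nz: "\<sigma> i \<noteq> 0" if "i \<in> {1..int n}" for i
      using permutes_in_image[OF p, of i] that by (auto simp: signed_range_def)
    have "(\<Prod>i=1..int n. sgn (\<sigma> i)) = (\<Prod>i=1..int n. if \<sigma> i < 0 then - 1 else 1)"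
      using nz by (intro prod.cong) (auto simp: sgn_if)
    also have "\<dots> = (\<Prod>i\<in>{i \<in> {1..int n}. \<sigma> i < 0}. - 1)"
      by (simp add: prod.If_cases Int_def)
    finally show ?thesis by simp
  qed
  then show ?thesis by (auto simp: D_perms_def minus_one_power_iff split: if_splits)
qed

lemma sgn_prod_comp:
  assumes "\<sigma> \<in> B_perms n" "\<tau> \<in> B_perms n"
  shows "(\<Prod>i=1..int n. sgn ((\<sigma> \<circ> \<tau>) i)) =
    (\<Prod>i=1..int n. sgn (\<sigma> i)) * (\<Prod>i=1..int n. sgn (\<tau> i))"
proof -
  have p: "\<tau> permutes signed_range n" and o: "\<And>i. \<tau> (- i) = - \<tau> i"
    and os: "\<And>i. \<sigma> (- i) = - \<sigma> i"
    using assms by (auto simp: B_perms_iff)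
  have im: "\<tau> i \<in> signed_range n" if "i \<in> {1..int n}" for i
    using permutes_in_image[OF p, of i] that by (auto simp: signed_range_def)
  have inj: "inj_on (\<lambda>i. \<bar>\<tau> i\<bar>) {1..int n}"
  proof (rule inj_onI)
    fix i j assume ij: "i \<in> {1..int n}" "j \<in> {1..int n}" "\<bar>\<tau> i\<bar> = \<bar>\<tau> j\<bar>"
    then have "\<tau> i = \<tau> j \<or> \<tau> i = \<tau> (- j)" by (auto simp: o abs_eq_iff)
    then have "i = j \<or> i = - j" using permutes_inj[OF p] by (auto dest: injD)
    then show "i = j" using ij by auto
  qed
  have sub: "(\<lambda>i. \<bar>\<tau> i\<bar>) ` {1..int n} \<subseteq> {1..int n}"
    using im by (fastforce simp: signed_range_def)
  have bij: "bij_betw (\<lambda>i. \<bar>\<tau> i\<bar>) {1..int n} {1..int n}"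
    using inj endo_inj_surj[OF _ sub inj] by (simp add: bij_betw_def)
  have "sgn (\<sigma> (\<tau> i)) = sgn (\<sigma> \<bar>\<tau> i\<bar>) * sgn (\<tau> i)" if "i \<in> {1..int n}" for i
    using im[OF that] os[of "\<tau> i"] by (auto simp: signed_range_def abs_if sgn_if)
  then have "(\<Prod>i=1..int n. sgn ((\<sigma> \<circ> \<tau>) i)) =
      (\<Prod>i=1..int n. sgn (\<sigma> \<bar>\<tau> i\<bar>)) * (\<Prod>i=1..int n. sgn (\<tau> i))"
    by (simp add: prod.distrib)
  then show ?thesis
    using prod.reindex_bij_betw[OF bij, of "\<lambda>i. sgn (\<sigma> i)"] by simp
qed

lemma id_in_D_perms: "id \<in> D_perms n"
  by (auto simp: D_perms_iff id_in_B_perms)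

lemma D_perms_comp: "\<sigma> \<in> D_perms n \<Longrightarrow> \<tau> \<in> D_perms n \<Longrightarrow> \<sigma> \<circ> \<tau> \<in> D_perms n"
  using sgn_prod_comp[of \<sigma> n \<tau>] by (simp add: D_perms_iff B_perms_comp)

lemma D_perms_inv:
  assumes "\<sigma> \<in> D_perms n" shows "inv_into UNIV \<sigma> \<in> D_perms n"
proof -
  have b: "\<sigma> \<in> B_perms n" using assms by (simp add: D_perms_iff)
  then have "inv_into UNIV \<sigma> \<circ> \<sigma> = id"
    by (auto simp: B_perms_def dest: permutes_inv_o)
  then show ?thesis
    using sgn_prod_comp[OF B_perms_inv[OF b] b] assms id_in_D_perms[of n]
    by (simp add: D_perms_iff B_perms_inv)
qed

lemma D_perms_mono:
  assumes "m \<le> n" shows "D_perms m \<subseteq> D_perms n"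
proof
  fix \<sigma> assume s: "\<sigma> \<in> D_perms m"
  then have p: "\<sigma> permutes signed_range m" by (simp add: D_perms_def B_perms_def)
  have "{i \<in> {1..int n}. \<sigma> i < 0} = {i \<in> {1..int m}. \<sigma> i < 0}" (is "?L = ?R")
  proof (rule Set.set_eqI)
    fix i
    have "\<sigma> i = i" if "i > int m"
      using permutes_not_in[OF p, of i] that by (auto simp: signed_range_def)
    then show "i \<in> ?L \<longleftrightarrow> i \<in> ?R" using assms by (cases "i \<le> int m") auto
  qed
  then show "\<sigma> \<in> D_perms n" using s B_perms_mono[OF assms] by (auto simp: D_perms_def)
qed

lemma group_B_inf: "group B_inf"
proof (rule groupI)
  fix x y assume "x \<in> carrier B_inf" "y \<in> carrier B_inf"
  then obtain m n where "x \<in> B_perms m" "y \<in> B_perms n" by (auto simp: B_inf_def)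
  then have "x \<in> B_perms (max m n)" "y \<in> B_perms (max m n)"
    using B_perms_mono by (meson max.cobounded1 max.cobounded2 subsetD)+
  then show "x \<otimes>\<^bsub>B_inf\<^esub> y \<in> carrier B_inf" by (auto simp: B_inf_def intro: B_perms_comp)
next
  fix x assume "x \<in> carrier B_inf"
  then obtain n where x: "x \<in> B_perms n" by (auto simp: B_inf_def)
  then have "inv_into UNIV x \<circ> x = id" by (auto simp: B_perms_def dest: permutes_inv_o)
  then show "\<exists>y\<in>carrier B_inf. y \<otimes>\<^bsub>B_inf\<^esub> x = \<one>\<^bsub>B_inf\<^esub>"
    using B_perms_inv[OF x] by (auto simp: B_inf_def)
qed (auto simp: B_inf_def id_in_B_perms o_assoc)

lemma group_D_inf: "group D_inf"
proof (rule groupI)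
  fix x y assume "x \<in> carrier D_inf" "y \<in> carrier D_inf"
  then obtain m n where "x \<in> D_perms m" "y \<in> D_perms n" by (auto simp: D_inf_def)
  then have "x \<in> D_perms (max m n)" "y \<in> D_perms (max m n)"
    using D_perms_mono by (meson max.cobounded1 max.cobounded2 subsetD)+
  then show "x \<otimes>\<^bsub>D_inf\<^esub> y \<in> carrier D_inf" by (auto simp: D_inf_def intro: D_perms_comp)
next
  fix x assume "x \<in> carrier D_inf"
  then obtain n where x: "x \<in> D_perms n" by (auto simp: D_inf_def)
  then have "inv_into UNIV x \<circ> x = id" by (auto simp: D_perms_def B_perms_def dest: permutes_inv_o)
  then show "\<exists>y\<in>carrier D_inf. y \<otimes>\<^bsub>D_inf\<^esub> x = \<one>\<^bsub>D_inf\<^esub>"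
    using D_perms_inv[OF x] by (auto simp: D_inf_def)
qed (auto simp: D_inf_def id_in_D_perms o_assoc)

end

theory Submission
  imports Defs
begin

text \<open>
  Let \<open>B(n)\<close> act on the odd functions from \<open>{-n..n}\<close> to \<open>{-N..N}\<close> and put \<open>M = 2 * N + 1\<close>. A signed
  permutation \<open>\<sigma>\<close> fixes exactly \<open>M ^ (n - \<ell> \<sigma>)\<close> of these functions, because a reflection changes the
  number of fixed functions by a factor of at most \<open>M\<close>, and gains this factor if it makes a point fixed.
  Thus \<open>M ^ - \<ell> \<sigma>\<close> is a normalised permutation character, and \<open>(- M) ^ - \<ell> \<sigma>\<close> is its product with the
  determinant. Since \<open>\<ell>\<close> is additive on elements with disjoint supports, the function is extreme: for
  conjugates \<open>s\<^sub>1, \<dots>, s\<^sub>n\<close> of \<open>g\<close> with disjoint supports, a character \<open>\<chi>\<close> satisfies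
  \<open>\<Sum> \<chi> (s\<^sub>j\<inverse> s\<^sub>i) \<ge> n\<^sup>2 |\<chi> g|\<^sup>2\<close>, and \<open>n \<rightarrow> \<infinity>\<close> together with strict convexity of
  \<open>|z|\<^sup>2\<close> forces the components of a convex decomposition to agree at \<open>g\<close>.

  Conversely, testing positive definiteness on \<open>D(n)\<close> against the trivial character and the determinant
  gives \<open>\<Sum>p ^ \<ell> \<sigma> \<ge> 0\<close> for \<open>p = - |q|\<close>. By the product formula this sum is
  \<open>(1 + p) (1 + 3 p) \<dots> (1 + (2 n - 3) p) (1 + (n - 1) p)\<close>, which is nonnegative for all \<open>n\<close> only if
  \<open>q = 0\<close> or \<open>1 / |q|\<close> is an odd integer.
\<close>

section \<open>Signed permutations and vectors fixed by them\<close>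

text \<open>One formula for both kinds of reflection: for \<open>j = - i\<close> it changes the sign
  of a coordinate, for distinct absolute values it is \<open>(i j)(- i - j)\<close>. For
  \<open>i = j\<close> it degenerates to the identity, so inductions need no case
  distinction.\<close>

definition signed_swap :: "int \<Rightarrow> int \<Rightarrow> int \<Rightarrow> int"
  where "signed_swap i j k =
    (if k = i then j else if k = j then i else if k = - i then - j else if k = - j then - i else k)"

lemma signed_swap_minus: "i \<noteq> 0 \<Longrightarrow> j \<noteq> 0 \<Longrightarrow> signed_swap i j (- k) = - signed_swap i j k"
  by (auto simp: signed_swap_def)

lemma signed_swap_invol [simp]: "i \<noteq> 0 \<Longrightarrow> j \<noteq> 0 \<Longrightarrow> signed_swap i j (signed_swap i j k) = k"
  by (auto simp: signed_swap_def)

lemma signed_swap_comp [simp]: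
  "i \<noteq> 0 \<Longrightarrow> j \<noteq> 0 \<Longrightarrow> signed_swap i j \<circ> (signed_swap i j \<circ> \<sigma>) = \<sigma>"
  by (simp add: fun_eq_iff)

lemma signed_swap_simps [simp]: "signed_swap i j i = j" "signed_swap i j j = i"
  by (auto simp: signed_swap_def)

lemma signed_swap_commute: "signed_swap i j = signed_swap j i"
  by (rule ext) (simp add: signed_swap_def)

lemma signed_range_iff: "i \<in> signed_range n \<longleftrightarrow> i \<noteq> 0 \<and> \<bar>i\<bar> \<le> int n"
  by (auto simp: signed_range_def)

lemma finite_signed_range [simp]: "finite (signed_range n)"
  by (simp add: signed_range_def)

lemma signed_swap_in_B_perms:
  assumes "i \<in> signed_range n" "j \<in> signed_range n"
  shows "signed_swap i j \<in> B_perms n"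
proof -
  have nz: "i \<noteq> 0" "j \<noteq> 0" using assms by (auto simp: signed_range_iff)
  then have "bij (signed_swap i j)"
    by (intro o_bij[of "signed_swap i j"]) (auto simp: fun_eq_iff)
  moreover have "\<forall>k. k \<notin> signed_range n \<longrightarrow> signed_swap i j k = k"
    using assms by (auto simp: signed_swap_def signed_range_iff)
  ultimately show ?thesis
    using nz by (auto simp: B_perms_iff permutes_def bij_iff signed_swap_minus)
qed

lemma D_refl_eq:
  "D_refl n = {signed_swap i j | i j. i \<in> signed_range n \<and> j \<in> signed_range n \<and> \<bar>i\<bar> \<noteq> \<bar>j\<bar>}"
proof -
  have "transpose i j \<circ> transpose (- i) (- j) = signed_swap i j"
    if "\<bar>i\<bar> \<noteq> \<bar>j\<bar>" "i \<noteq> 0" "j \<noteq> 0" for i j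
    using that by (auto simp: fun_eq_iff signed_swap_def transpose_def abs_if split: if_splits)
  then have "(i \<in> signed_range n \<and> j \<in> signed_range n \<and> \<bar>i\<bar> \<noteq> \<bar>j\<bar>) \<Longrightarrow>
      transpose i j \<circ> transpose (- i) (- j) = signed_swap i j" for i j
    by (simp add: signed_range_iff)
  then show ?thesis unfolding D_refl_def by (metis (no_types, lifting))
qed

lemma B_refl_eq:
  "B_refl n = {signed_swap i j | i j. i \<in> signed_range n \<and> j \<in> signed_range n \<and> i \<noteq> j}"
    (is "_ = ?R")
proof
  have t: "transpose i (- i) = signed_swap i (- i)" for i :: int
    by (auto simp: fun_eq_iff signed_swap_def transpose_def)
  have "signed_swap i (- i) \<in> ?R" if "1 \<le> i" "i \<le> int n" for i
    unfolding mem_Collect_eq using that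
    by (intro exI[of _ i] exI[of _ "- i"]) (auto simp: signed_range_iff)
  then show "B_refl n \<subseteq> ?R"
    unfolding B_refl_def D_refl_eq t by blast
  show "?R \<subseteq> B_refl n"
  proof
    fix s assume "s \<in> ?R"
    then obtain i j where ij: "s = signed_swap i j" "i \<in> signed_range n" "j \<in> signed_range n" "i \<noteq> j"
      by auto
    show "s \<in> B_refl n"
    proof (cases "\<bar>i\<bar> = \<bar>j\<bar>")
      case True
      then have "j = - i" using ij(4) by (metis abs_eq_iff)
      then have "s = signed_swap \<bar>i\<bar> (- \<bar>i\<bar>)"
        unfolding ij(1) using signed_swap_commute[of i "- i"] by (cases "i \<ge> 0") simp_all
      then have "\<exists>i. s = transpose i (- i) \<and> 1 \<le> i \<and> i \<le> int n"
        unfolding t using ij by (intro exI[of _ "\<bar>i\<bar>"]) (auto simp: signed_range_iff)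
      then show ?thesis by (auto simp: B_refl_def)
    next
      case False
      then show ?thesis using ij by (auto simp: B_refl_def D_refl_eq)
    qed
  qed
qed

lemma B_refl_mono: "m \<le> n \<Longrightarrow> B_refl m \<subseteq> B_refl n"
  by (fastforce simp: B_refl_eq signed_range_iff)

lemma D_refl_subset_B_refl: "D_refl n \<subseteq> B_refl n"
  by (auto simp: B_refl_def)

text \<open>The product of signs is the homomorphism that cuts \<open>D_perms n\<close> out of
  \<open>B_perms n\<close>. Only the points \<open>\<bar>i\<bar>\<close> and
  \<open>\<bar>j\<bar>\<close> contribute; if these differ, \<open>sgn i\<close> and
  \<open>sgn j\<close> each occur twice and cancel.\<close>

lemma prod_sgn_signed_swap:
  assumes "i \<in> signed_range n" "j \<in> signed_range n" "i \<noteq> j"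
  shows "(\<Prod>k=1..int n. sgn (signed_swap i j k)) = (if j = - i then - 1 else 1)"
proof -
  have "(\<Prod>k=1..int n. sgn (signed_swap i j k)) = (\<Prod>k\<in>{\<bar>i\<bar>, \<bar>j\<bar>}. sgn (signed_swap i j k))"
    using assms
    by (intro prod.mono_neutral_right) (auto simp: signed_range_iff signed_swap_def sgn_if abs_if split: if_splits)
  also have "\<dots> = (if j = - i then - 1 else 1)"
  proof (cases "\<bar>i\<bar> = \<bar>j\<bar>")
    case True
    then have j: "j = - i" using assms by auto
    have "signed_swap i (- i) \<bar>i\<bar> = - \<bar>i\<bar>" by (auto simp: signed_swap_def abs_if)
    then show ?thesis using assms(1) unfolding j by (simp add: signed_range_iff sgn_if)
  next
    case False
    have "signed_swap i j \<bar>i\<bar> = sgn i * j" "signed_swap i j \<bar>j\<bar> = sgn j * i"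
      using signed_swap_minus[of i j i] signed_swap_minus[of i j j] assms(1,2)
      by (simp_all add: signed_range_iff abs_if sgn_if)
    then have "(\<Prod>k\<in>{\<bar>i\<bar>, \<bar>j\<bar>}. sgn (signed_swap i j k)) = (sgn i * sgn i) * (sgn j * sgn j)"
      using False by (simp add: sgn_mult mult_ac)
    also have "\<dots> = 1" using assms(1,2) by (simp add: signed_range_iff sgn_if)
    finally have "(\<Prod>k\<in>{\<bar>i\<bar>, \<bar>j\<bar>}. sgn (signed_swap i j k)) = 1" .
    moreover have "j \<noteq> - i" using False by (metis abs_minus_cancel)
    ultimately show ?thesis by simp
  qed
  finally show ?thesis .
qed

lemma D_refl_subset: "D_refl n \<subseteq> D_perms n"
proof
  fix s assume "s \<in> D_refl n"
  then obtain i j where "s = signed_swap i j" "i \<in> signed_range n" "j \<in> signed_range n" "\<bar>i\<bar> \<noteq> \<bar>j\<bar>"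
    by (auto simp: D_refl_eq)
  moreover from this have "i \<noteq> j" "j \<noteq> - i" by auto
  ultimately show "s \<in> D_perms n"
    by (simp add: D_perms_iff signed_swap_in_B_perms prod_sgn_signed_swap)
qed

section \<open>Elementary facts on signed permutations and induction by swaps\<close>

lemma B_perms_minus: "\<sigma> \<in> B_perms n \<Longrightarrow> \<sigma> (- i) = - \<sigma> i"
  by (simp add: B_perms_iff)

lemma B_perms_inj: "\<sigma> \<in> B_perms n \<Longrightarrow> \<sigma> i = \<sigma> j \<longleftrightarrow> i = j"
  by (metis B_perms_iff permutes_inverses(2))

lemma B_perms_in_range: "\<sigma> \<in> B_perms n \<Longrightarrow> \<sigma> i \<in> signed_range n \<longleftrightarrow> i \<in> signed_range n"
  by (metis B_perms_iff permutes_in_image)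

lemma B_perms_outside: "\<sigma> \<in> B_perms n \<Longrightarrow> i \<notin> signed_range n \<Longrightarrow> \<sigma> i = i"
  by (metis B_perms_iff permutes_def)

lemma finite_moved:
  assumes "\<sigma> \<in> B_perms n" shows "finite {k. \<sigma> k \<noteq> k}"
  using B_perms_outside[OF assms] by (intro finite_subset[OF _ finite_signed_range[of n]]) auto

text \<open>Undoing one swap fixes \<open>i\<close> without losing fixed points: by injectivity and
  oddness, no point fixed by \<open>\<sigma>\<close> is among \<open>i\<close>, \<open>- i\<close>,
  \<open>\<sigma> i\<close>, \<open>- \<sigma> i\<close>.\<close>

lemma signed_swap_reduce:
  assumes s: "\<sigma> \<in> B_perms n" and i: "\<sigma> i \<noteq> i"
  defines "\<tau> \<equiv> signed_swap i (\<sigma> i) \<circ> \<sigma>"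
  shows "\<tau> \<in> B_perms n" "\<tau> i = i" "i \<in> signed_range n" "\<sigma> i \<in> signed_range n"
    "signed_swap i (\<sigma> i) \<circ> \<tau> = \<sigma>" "{k. \<tau> k \<noteq> k} \<subset> {k. \<sigma> k \<noteq> k}"
proof -
  show ir: "i \<in> signed_range n" "\<sigma> i \<in> signed_range n"
    using B_perms_outside[OF s] i B_perms_in_range[OF s] by auto
  show "\<tau> \<in> B_perms n" unfolding \<tau>_def
    using ir s by (intro B_perms_comp signed_swap_in_B_perms)
  show ti: "\<tau> i = i" by (simp add: \<tau>_def)
  show "signed_swap i (\<sigma> i) \<circ> \<tau> = \<sigma>" using ir by (simp add: \<tau>_def signed_range_iff)
  have "\<tau> k = k" if "\<sigma> k = k" for k
  proof -
    have "k \<noteq> \<sigma> i" using B_perms_inj[OF s, of k i] that i by auto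
    moreover have "k \<noteq> - \<sigma> i"
      using B_perms_inj[OF s, of k "- i"] that i by (auto simp: B_perms_minus[OF s])
    moreover have "k \<noteq> i" "k \<noteq> - i" using that i B_perms_minus[OF s, of i] by auto
    ultimately show ?thesis using that by (simp add: \<tau>_def signed_swap_def)
  qed
  then have "{k. \<tau> k \<noteq> k} \<subseteq> {k. \<sigma> k \<noteq> k}" by blast
  then show "{k. \<tau> k \<noteq> k} \<subset> {k. \<sigma> k \<noteq> k}" using ti i by blast
qed

text \<open>Induction on the number of moved points. The side condition \<open>\<tau> i = i\<close>
  is the point of the rule: under it each swap raises the reflection length by exactly one.\<close>

lemma B_perms_induct [consumes 1, case_names id swap]:
  assumes "\<sigma> \<in> B_perms n" and id: "P id"
    and swap: "\<And>\<tau> i j. \<tau> \<in> B_perms n \<Longrightarrow> i \<in> signed_range n \<Longrightarrow> j \<in> signed_range n \<Longrightarrow>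
      \<tau> i = i \<Longrightarrow> i \<noteq> j \<Longrightarrow> P \<tau> \<Longrightarrow> P (signed_swap i j \<circ> \<tau>)"
  shows "P \<sigma>"
  using assms(1)
proof (induction "card {k. \<sigma> k \<noteq> k}" arbitrary: \<sigma> rule: less_induct)
  case less
  show ?case
  proof (cases "\<sigma> = id")
    case False
    then obtain i where i: "\<sigma> i \<noteq> i" by (auto simp: fun_eq_iff)
    note r = signed_swap_reduce[OF less.prems i]
    have "P (signed_swap i (\<sigma> i) \<circ> \<sigma>)"
      using less.hyps psubset_card_mono[OF finite_moved[OF less.prems] r(6)] r(1) by blast
    then show ?thesis using swap[OF r(1) r(3) r(4) r(2)] i r(5) by metis
  qed (simp add: id)
qed

section \<open>Counting odd vectors fixed by a signed permutation\<close>

definition odd_vectors :: "nat \<Rightarrow> nat \<Rightarrow> (int \<Rightarrow> int) set"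
  where "odd_vectors N n =
    {x. (\<forall>k. x (- k) = - x k) \<and> (\<forall>k. \<bar>x k\<bar> \<le> int N) \<and> (\<forall>k. k \<notin> signed_range n \<longrightarrow> x k = 0)}"

definition fixed_vectors :: "nat \<Rightarrow> nat \<Rightarrow> (int \<Rightarrow> int) \<Rightarrow> (int \<Rightarrow> int) set"
  where "fixed_vectors N n \<sigma> = {x \<in> odd_vectors N n. x \<circ> \<sigma> = x}"

text \<open>An odd function is determined by its values on \<open>{1..int n}\<close>, which are
  arbitrary letters of the alphabet \<open>{- int N..int N}\<close>. Negation fixes only the letter
  0, so a sign change will cost the same factor \<open>2 * N + 1\<close> as a transposition.\<close>

lemma card_odd_vectors: "card (odd_vectors N n) = (2 * N + 1) ^ n"
  and finite_odd_vectors [simp]: "finite (odd_vectors N n)"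
proof -
  let ?E = "{1..int n} \<rightarrow>\<^sub>E {- int N..int N}"
  let ?ext = "\<lambda>y k. if k \<in> {1..int n} then y k else if - k \<in> {1..int n} then - y (- k) else 0"
  have "bij_betw (\<lambda>x. restrict x {1..int n}) (odd_vectors N n) ?E"
  proof (rule bij_betw_byWitness[where f' = ?ext])
    show "\<forall>x\<in>odd_vectors N n. ?ext (restrict x {1..int n}) = x"
    proof
      fix x assume "x \<in> odd_vectors N n"
      then have "x (- k) = - x k" "k \<notin> signed_range n \<Longrightarrow> x k = 0" for k
        by (auto simp: odd_vectors_def)
      moreover have "k \<notin> signed_range n" if "k \<notin> {1..int n}" "- k \<notin> {1..int n}" for k
        using that by (auto simp: signed_range_iff)
      ultimately show "?ext (restrict x {1..int n}) = x"
        by (auto simp del: atLeastAtMost_iff simp: fun_eq_iff)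
    qed
    show "\<forall>y\<in>?E. restrict (?ext y) {1..int n} = y"
      by (auto simp: fun_eq_iff PiE_def extensional_def)
    show "(\<lambda>x. restrict x {1..int n}) ` odd_vectors N n \<subseteq> ?E"
      by (auto simp: odd_vectors_def abs_le_iff minus_le_iff)
    show "?ext ` ?E \<subseteq> odd_vectors N n"
    proof
      fix x assume "x \<in> ?ext ` ?E"
      then obtain y where y: "y \<in> ?E" and x: "x = ?ext y" by auto
      have b: "\<bar>y k\<bar> \<le> int N" if "k \<in> {1..int n}" for k
        using PiE_mem[OF y that] by auto
      have "x (- k) = - x k" "\<bar>x k\<bar> \<le> int N" "k \<notin> signed_range n \<longrightarrow> x k = 0" for k
        unfolding x using b[of k] b[of "- k"] by (auto simp: signed_range_iff)
      then show "x \<in> odd_vectors N n" unfolding odd_vectors_def by blast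
    qed
  qed
  moreover have "finite ?E" by (intro finite_PiE) auto
  moreover have "card ?E = (2 * N + 1) ^ n"
    by (subst card_PiE) (auto simp: nat_add_distrib nat_mult_distrib)
  ultimately show "card (odd_vectors N n) = (2 * N + 1) ^ n" "finite (odd_vectors N n)"
    by (auto simp: bij_betw_same_card bij_betw_finite)
qed

lemma finite_fixed_vectors [simp]: "finite (fixed_vectors N n \<sigma>)"
  by (simp add: fixed_vectors_def)

lemma card_fixed_vectors_id: "card (fixed_vectors N n id) = (2 * N + 1) ^ n"
  by (simp add: fixed_vectors_def card_odd_vectors)

lemma odd_comp_signed_swap:
  assumes "\<And>k. x (- k) = - (x k :: int)" "x i = x j"
  shows "x \<circ> signed_swap i j = x"
  using assms by (auto simp: fun_eq_iff signed_swap_def)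

text \<open>The representative modulo \<open>2 * N + 1\<close> of least absolute value. This
  symmetric choice commutes with negation, so reducing an odd vector leaves it odd.\<close>

definition balanced_mod :: "nat \<Rightarrow> int \<Rightarrow> int"
  where "balanced_mod N z = (z + int N) mod (2 * int N + 1) - int N"

lemma balanced_mod_bound: "\<bar>balanced_mod N z\<bar> \<le> int N"
proof -
  have "0 \<le> (z + int N) mod (2 * int N + 1)" "(z + int N) mod (2 * int N + 1) < 2 * int N + 1"
    by (intro pos_mod_sign pos_mod_bound; simp)+
  then show ?thesis unfolding balanced_mod_def by linarith
qed

lemma balanced_mod_cong: "\<exists>c. z = balanced_mod N z + c * (2 * int N + 1)"
proof -
  have "z + int N = (z + int N) mod (2 * int N + 1) + (z + int N) div (2 * int N + 1) * (2 * int N + 1)"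
    by (rule mod_div_mult_eq[symmetric])
  then have "z = balanced_mod N z + (z + int N) div (2 * int N + 1) * (2 * int N + 1)"
    unfolding balanced_mod_def by linarith
  then show ?thesis by blast
qed

lemma balanced_mod_unique:
  assumes "z = w + c * (2 * int N + 1)" "\<bar>w\<bar> \<le> int N"
  shows "balanced_mod N z = w"
proof -
  have "(z + int N) mod (2 * int N + 1) = ((w + int N) + c * (2 * int N + 1)) mod (2 * int N + 1)"
    unfolding assms(1) by (simp add: algebra_simps)
  also have "\<dots> = (w + int N) mod (2 * int N + 1)" by simp
  also have "\<dots> = w + int N" using assms(2) by (intro mod_pos_pos_trivial) auto
  finally show ?thesis by (simp add: balanced_mod_def)
qed

lemma balanced_mod_minus: "balanced_mod N (- z) = - balanced_mod N z"
proof -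
  obtain c where "z = balanced_mod N z + c * (2 * int N + 1)" using balanced_mod_cong by blast
  then have "- z = - balanced_mod N z + (- c) * (2 * int N + 1)" by (simp add: algebra_simps)
  then show ?thesis by (rule balanced_mod_unique) (simp add: balanced_mod_bound)
qed

lemma balanced_mod_eq_iff:
  "balanced_mod N a = balanced_mod N b \<longleftrightarrow> (2 * int N + 1) dvd (a - b)"
proof
  assume eq: "balanced_mod N a = balanced_mod N b"
  obtain c d where "a = balanced_mod N a + c * (2 * int N + 1)" "b = balanced_mod N b + d * (2 * int N + 1)"
    using balanced_mod_cong by metis
  then have "a - b = (c - d) * (2 * int N + 1)" using eq by (simp add: algebra_simps)
  then show "(2 * int N + 1) dvd (a - b)" by simp
next
  assume "(2 * int N + 1) dvd (a - b)"
  then obtain e where e: "a - b = (2 * int N + 1) * e" by auto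
  obtain d where "b = balanced_mod N b + d * (2 * int N + 1)" using balanced_mod_cong by metis
  then have "a = balanced_mod N b + (d + e) * (2 * int N + 1)" using e by (simp add: algebra_simps)
  then show "balanced_mod N a = balanced_mod N b" using balanced_mod_bound by (rule balanced_mod_unique)
qed

lemma balanced_mod_diff_inj:
  assumes "balanced_mod N (a - c) = balanced_mod N (b - c)" "\<bar>a\<bar> \<le> int N" "\<bar>b\<bar> \<le> int N"
  shows "a = b"
proof -
  have "(2 * int N + 1) dvd (a - b)" using assms(1) by (simp add: balanced_mod_eq_iff)
  moreover have "\<bar>a - b\<bar> < 2 * int N + 1" using assms by auto
  ultimately show ?thesis using dvd_imp_le_int[of "a - b" "2 * int N + 1"] by auto
qed

text \<open>
  Reduction modulo \<open>2 * N + 1\<close> turns the fixed vectors into an abelian group, on which the condition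
  \<open>x i = x j\<close> cuts out a subgroup of index at most \<open>2 * N + 1\<close>.
\<close>

lemma card_fixed_vectors_signed_swap_le:
  "card (fixed_vectors N n \<sigma>) \<le> (2 * N + 1) * card (fixed_vectors N n (signed_swap i j \<circ> \<sigma>))"
proof -
  let ?A = "fixed_vectors N n \<sigma>"
  let ?B = "fixed_vectors N n (signed_swap i j \<circ> \<sigma>)"
  \<comment> \<open>The cosets of the subgroup \<open>x i = x j\<close>, indexed by the residue of
    \<open>x i - x j\<close>; there are at most \<open>2 * N + 1\<close> of them.\<close>
  define fib where "fib c = {x \<in> ?A. balanced_mod N (x i - x j) = c}" for c
  have fib: "card (fib c) \<le> card ?B" for c
  proof (cases "fib c = {}")
    case False
    then obtain x0 where x0: "x0 \<in> fib c" by auto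
    \<comment> \<open>Translation by a base point \<open>x0\<close> of the coset, followed by
      reduction, embeds the coset into the subgroup.\<close>
    let ?f = "\<lambda>x k. balanced_mod N (x k - x0 k)"
    have "inj_on ?f (fib c)"
    proof (rule inj_onI)
      fix x y assume xy: "x \<in> fib c" "y \<in> fib c" and eq: "?f x = ?f y"
      then have "x k = y k" for k
        using fun_cong[OF eq, of k]
        by (intro balanced_mod_diff_inj[of N "x k" "x0 k" "y k"])
           (auto simp: fib_def fixed_vectors_def odd_vectors_def)
      then show "x = y" by blast
    qed
    moreover have "?f ` fib c \<subseteq> ?B"
    proof
      fix y assume "y \<in> ?f ` fib c"
      then obtain x where x: "x \<in> fib c" and y: "y = ?f x" by auto
      have odd: "x (- k) = - x k" "x0 (- k) = - x0 k" for k
        using x x0 by (auto simp: fib_def fixed_vectors_def odd_vectors_def)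
      have yodd: "y (- k) = - y k" for k
        unfolding y using odd balanced_mod_minus[of N "x k - x0 k"] by simp
      have "balanced_mod N 0 = 0" by (rule balanced_mod_unique[of _ _ 0]) auto
      then have "y \<in> odd_vectors N n"
        using x x0 yodd balanced_mod_bound
        by (auto simp: odd_vectors_def y fib_def fixed_vectors_def)
      moreover have "y i = y j"
      proof -
        have "balanced_mod N (x i - x j) = balanced_mod N (x0 i - x0 j)"
          using x x0 by (simp add: fib_def)
        then show ?thesis unfolding y balanced_mod_eq_iff by (simp add: algebra_simps)
      qed
      then have "y \<circ> signed_swap i j = y" using odd_comp_signed_swap yodd by blast
      moreover have "y \<circ> \<sigma> = y"
      proof -
        have "x (\<sigma> k) = x k" "x0 (\<sigma> k) = x0 k" for k
          using x x0 by (auto simp: fib_def fixed_vectors_def fun_eq_iff)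
        then show ?thesis by (simp add: y fun_eq_iff)
      qed
      ultimately show "y \<in> ?B" by (simp add: fixed_vectors_def o_assoc)
    qed
    ultimately show ?thesis by (intro card_inj_on_le[of ?f]) auto
  qed simp
  have "?A \<subseteq> (\<Union>c\<in>{- int N..int N}. fib c)"
    using balanced_mod_bound[of N] by (auto simp: fib_def abs_le_iff minus_le_iff)
  then have "card ?A \<le> card (\<Union>c\<in>{- int N..int N}. fib c)"
    by (intro card_mono) (auto simp: fib_def)
  also have "\<dots> \<le> (\<Sum>c\<in>{- int N..int N}. card (fib c))" by (rule card_UN_le) simp
  also have "\<dots> \<le> (\<Sum>c\<in>{- int N..int N}. card ?B)" by (intro sum_mono fib)
  also have "\<dots> = (2 * N + 1) * card ?B" by (simp add: nat_add_distrib nat_mult_distrib)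
  finally show ?thesis .
qed

text \<open>As \<open>\<tau>\<close> fixes \<open>i\<close> and \<open>- i\<close>, the entry
  \<open>x i\<close> is a free coordinate of a vector fixed by \<open>\<tau>\<close>. The swap adds
  the single condition \<open>x i = x j\<close>, which determines this entry.\<close>

lemma card_fixed_vectors_signed_swap:
  assumes t: "\<tau> \<in> B_perms n" and ij: "i \<in> signed_range n" "i \<noteq> j" and ti: "\<tau> i = i"
  shows "card (fixed_vectors N n \<tau>) = (2 * N + 1) * card (fixed_vectors N n (signed_swap i j \<circ> \<tau>))"
proof -
  let ?B = "fixed_vectors N n (signed_swap i j \<circ> \<tau>)"
  have B: "?B = {x \<in> fixed_vectors N n \<tau>. x i = x j}"
  proof (intro Set.set_eqI iffI)
    fix x assume "x \<in> {x \<in> fixed_vectors N n \<tau>. x i = x j}"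
    moreover from this have "x \<circ> signed_swap i j = x"
      by (intro odd_comp_signed_swap) (auto simp: fixed_vectors_def odd_vectors_def)
    ultimately show "x \<in> ?B" by (auto simp: fixed_vectors_def o_assoc)
  next
    fix x assume x: "x \<in> ?B"
    then have "x (signed_swap i j (\<tau> i)) = x i" by (metis (mono_tags) comp_apply fixed_vectors_def mem_Collect_eq)
    then have xij: "x i = x j" by (simp add: ti)
    then have "x \<circ> signed_swap i j = x"
      using x by (intro odd_comp_signed_swap) (auto simp: fixed_vectors_def odd_vectors_def)
    then show "x \<in> {x \<in> fixed_vectors N n \<tau>. x i = x j}"
      using x xij by (auto simp: fixed_vectors_def o_assoc)
  qed
  have tmi: "\<tau> (- i) = - i" by (simp add: B_perms_minus[OF t] ti)
  have i0: "i \<noteq> 0" "- i \<in> signed_range n" using ij by (auto simp: signed_range_iff)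
  have teq: "\<tau> k = i \<longleftrightarrow> k = i" "\<tau> k = - i \<longleftrightarrow> k = - i" for k
    using B_perms_inj[OF t, of k i] B_perms_inj[OF t, of k "- i"] by (simp_all add: ti tmi)
  have upd: "x(i := v, - i := - v) \<in> fixed_vectors N n \<tau>"
    if "x \<in> fixed_vectors N n \<tau>" "\<bar>v\<bar> \<le> int N" for x v
    using that i0 ij(1) by (auto simp: fixed_vectors_def odd_vectors_def fun_eq_iff teq)
  \<comment> \<open>The entry at \<open>i\<close> forced by \<open>x i = x j\<close>. For
    \<open>j = - i\<close> oddness turns the condition into \<open>x i = - x i\<close>, hence the
    value 0.\<close>
  define c where "c x = (if j = - i then 0 else x j)" for x :: "int \<Rightarrow> int"
  have c: "\<bar>c x\<bar> \<le> int N" if "x \<in> fixed_vectors N n \<tau>" for x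
    using that by (auto simp: c_def fixed_vectors_def odd_vectors_def)
  have "bij_betw (\<lambda>x. (x(i := c x, - i := - c x), x i)) (fixed_vectors N n \<tau>) (?B \<times> {- int N..int N})"
  proof (rule bij_betw_byWitness[where f' = "\<lambda>(x, v). x(i := v, - i := - v)"])
    show "\<forall>x\<in>fixed_vectors N n \<tau>. (case (x(i := c x, - i := - c x), x i) of (x, v) \<Rightarrow> x(i := v, - i := - v)) = x"
      by (auto simp: fun_eq_iff fixed_vectors_def odd_vectors_def)
    show "\<forall>p\<in>?B \<times> {- int N..int N}. (\<lambda>x. (x(i := c x, - i := - c x), x i)) (case p of (x, v) \<Rightarrow> x(i := v, - i := - v)) = p"
    proof
      fix p assume "p \<in> ?B \<times> {- int N..int N}"
      then obtain x v where p: "p = (x, v)" "x \<in> ?B" by auto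
      have odd: "x (- k) = - x k" for k using p by (auto simp: fixed_vectors_def odd_vectors_def)
      have "x i = x j" using p by (simp add: B)
      have "x i = 0" if "j = - i"
      proof -
        have "x i = - x i" using \<open>x i = x j\<close> odd[of i] that by metis
        then show ?thesis by simp
      qed
      then have "c x = x i" using \<open>x i = x j\<close> by (simp add: c_def)
      moreover have "c (x(i := v, - i := - v)) = c x" using ij by (auto simp: c_def)
      ultimately have cv: "c (x(i := v, - i := - v)) = x i" by simp
      have "(x(i := v, - i := - v))(i := x i, - i := - x i) = x"
        using odd[of i] by (simp add: fun_eq_iff)
      moreover have "(x(i := v, - i := - v)) i = v" using i0 by simp
      ultimately show "(\<lambda>x. (x(i := c x, - i := - c x), x i)) (case p of (x, v) \<Rightarrow> x(i := v, - i := - v)) = p"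
        unfolding p(1) case_prod_conv cv by simp
    qed
    show "(\<lambda>x. (x(i := c x, - i := - c x), x i)) ` fixed_vectors N n \<tau> \<subseteq> ?B \<times> {- int N..int N}"
    proof clarify
      fix x assume x: "x \<in> fixed_vectors N n \<tau>"
      have "\<bar>x i\<bar> \<le> int N" using x by (auto simp: fixed_vectors_def odd_vectors_def)
      moreover have "x(i := c x, - i := - c x) \<in> ?B"
        unfolding B using upd[OF x c[OF x]] ij i0 by (auto simp: c_def)
      ultimately show "x(i := c x, - i := - c x) \<in> ?B \<and> x i \<in> {- int N..int N}" by auto
    qed
    show "(\<lambda>(x, v). x(i := v, - i := - v)) ` (?B \<times> {- int N..int N}) \<subseteq> fixed_vectors N n \<tau>"
      using upd by (auto simp: B abs_le_iff)
  qed
  then have "card (fixed_vectors N n \<tau>) = card (?B \<times> {- int N..int N})" by (rule bij_betw_same_card)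
  then show ?thesis by (simp add: nat_add_distrib nat_mult_distrib)
qed

section \<open>Reflection length on \<open>B_inf\<close>\<close>

text \<open>The empty word fixes all \<open>(2 * N + 1) ^ n\<close> vectors, and each further
  reflection shrinks the count by a factor of at most \<open>2 * N + 1\<close>. This bounds the
  length of a word from below.\<close>

lemma card_fixed_vectors_word_ge:
  assumes "set rs \<subseteq> B_refl n"
  shows "(2 * N + 1) ^ n \<le> card (fixed_vectors N n (foldr (\<circ>) rs id)) * (2 * N + 1) ^ length rs"
  using assms
proof (induction rs)
  case Nil
  then show ?case by (simp add: card_fixed_vectors_id[unfolded id_def] id_def)
next
  case (Cons r rs)
  then obtain i j where r: "r = signed_swap i j" by (auto simp: B_refl_eq)
  have "(2 * N + 1) ^ n \<le> card (fixed_vectors N n (foldr (\<circ>) rs id)) * (2 * N + 1) ^ length rs"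
    by (rule Cons.IH) (use Cons.prems in simp)
  also have "\<dots> \<le> (2 * N + 1) * card (fixed_vectors N n (r \<circ> foldr (\<circ>) rs id)) * (2 * N + 1) ^ length rs"
    unfolding r by (intro mult_right_mono card_fixed_vectors_signed_swap_le) simp
  finally show ?case
    unfolding foldr_Cons comp_apply[of "(\<circ>) r"] length_Cons power_Suc by (simp only: mult_ac)
qed

text \<open>The word produced by the induction loses the full factor at every letter. The count is
  given for all \<open>m \<ge> n\<close>, because the length is defined in the union group, where
  competing words may use reflections of larger rank.\<close>

lemma card_fixed_vectors_word_eq:
  assumes "\<sigma> \<in> B_perms n"
  shows "\<exists>rs. set rs \<subseteq> B_refl n \<and> foldr (\<circ>) rs id = \<sigma> \<and>
    (\<forall>N. \<forall>m\<ge>n. card (fixed_vectors N m \<sigma>) * (2 * N + 1) ^ length rs = (2 * N + 1) ^ m)"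
  using assms
proof (induction rule: B_perms_induct)
  case id
  have "card (fixed_vectors N m id) * (2 * N + 1) ^ length [] = (2 * N + 1) ^ m" for N m
    by (simp add: card_fixed_vectors_id)
  moreover have "set [] \<subseteq> B_refl n" "foldr (\<circ>) [] id = (id :: int \<Rightarrow> int)" by simp_all
  ultimately show ?case by blast
next
  case (swap \<tau> i j)
  then obtain rs where rs: "set rs \<subseteq> B_refl n" "foldr (\<circ>) rs id = \<tau>"
    "\<And>N m. m \<ge> n \<Longrightarrow> card (fixed_vectors N m \<tau>) * (2 * N + 1) ^ length rs = (2 * N + 1) ^ m"
    by blast
  have "card (fixed_vectors N m (signed_swap i j \<circ> \<tau>)) * (2 * N + 1) ^ length (signed_swap i j # rs) =
      (2 * N + 1) ^ m" if "m \<ge> n" for N m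
  proof -
    have "\<tau> \<in> B_perms m" "i \<in> signed_range m"
      using swap(1,2) B_perms_mono that by (auto simp: signed_range_iff)
    from card_fixed_vectors_signed_swap[OF this swap(5,4)]
    show ?thesis using rs(3)[OF that, of N] by (simp only: length_Cons power_Suc mult_ac)
  qed
  moreover have "signed_swap i j \<in> B_refl n" using swap by (auto simp: B_refl_eq)
  moreover from this have "set (signed_swap i j # rs) \<subseteq> B_refl n"
    "foldr (\<circ>) (signed_swap i j # rs) id = signed_swap i j \<circ> \<tau>"
    using rs(1,2) by auto
  ultimately show ?case by blast
qed

text \<open>Comparing the exact count for the constructed word with the lower bound for any other
  word, at a rank large enough for both, shows that the constructed word is shortest.\<close>

lemma
  assumes "\<sigma> \<in> B_perms n"
  shows card_fixed_vectors_B_length: "card (fixed_vectors N n \<sigma>) * (2 * N + 1) ^ B_length \<sigma> = (2 * N + 1) ^ n"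
    and ex_word_B_length: "\<exists>rs. set rs \<subseteq> B_refl n \<and> foldr (\<circ>) rs id = \<sigma> \<and> length rs = B_length \<sigma>"
    and B_length_le: "set ws \<subseteq> (\<Union>n. B_refl n) \<Longrightarrow> foldr (\<circ>) ws id = \<sigma> \<Longrightarrow> B_length \<sigma> \<le> length ws"
proof -
  obtain rs where rs: "set rs \<subseteq> B_refl n" "foldr (\<circ>) rs id = \<sigma>"
    "\<And>N m. m \<ge> n \<Longrightarrow> card (fixed_vectors N m \<sigma>) * (2 * N + 1) ^ length rs = (2 * N + 1) ^ m"
    using card_fixed_vectors_word_eq[OF assms] by blast
  have le: "length rs \<le> length ws" if ws: "set ws \<subseteq> (\<Union>n. B_refl n)" "foldr (\<circ>) ws id = \<sigma>" for ws
  proof -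
    have "\<exists>m\<ge>n. set ws \<subseteq> B_refl m"
      using ws(1)
    proof (induction ws)
      case (Cons w ws)
      then obtain m k where "n \<le> m" "set ws \<subseteq> B_refl m" "w \<in> B_refl k" by auto
      then show ?case
        using B_refl_mono[of m "max m k"] B_refl_mono[of k "max m k"]
        by (intro exI[of _ "max m k"]) auto
    qed auto
    then obtain m where m: "m \<ge> n" "set ws \<subseteq> B_refl m" by blast
    have "card (fixed_vectors 1 m \<sigma>) * 3 ^ length rs \<le> card (fixed_vectors 1 m \<sigma>) * 3 ^ length ws"
      using card_fixed_vectors_word_ge[OF m(2), of 1] rs(3)[OF m(1), of 1] ws(2) by simp
    moreover have "card (fixed_vectors 1 m \<sigma>) > 0"
      using rs(3)[OF m(1), of 1] by (intro gr0I) simp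
    ultimately show ?thesis by simp
  qed
  have len: "B_length \<sigma> = length rs"
    unfolding B_length_def word_length_def B_inf_def monoid.select_convs
    by (rule Least_equality) (use rs(1,2) le in blast)+
  show "card (fixed_vectors N n \<sigma>) * (2 * N + 1) ^ B_length \<sigma> = (2 * N + 1) ^ n"
    using rs(3)[of n N] len by simp
  show "\<exists>rs. set rs \<subseteq> B_refl n \<and> foldr (\<circ>) rs id = \<sigma> \<and> length rs = B_length \<sigma>"
    by (intro exI[of _ rs]) (simp add: rs(1,2) len)
  show "set ws \<subseteq> (\<Union>n. B_refl n) \<Longrightarrow> foldr (\<circ>) ws id = \<sigma> \<Longrightarrow> B_length \<sigma> \<le> length ws"
    using le len by simp
qed

text \<open>The single value \<open>N = 1\<close> already determines the length, since powers of 3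
  determine their exponent.\<close>

lemma B_length_eqI:
  assumes "\<sigma> \<in> B_perms n" "card (fixed_vectors 1 n \<sigma>) * 3 ^ k = 3 ^ n"
  shows "B_length \<sigma> = k"
proof -
  have "card (fixed_vectors 1 n \<sigma>) * 3 ^ B_length \<sigma> = card (fixed_vectors 1 n \<sigma>) * 3 ^ k"
    using card_fixed_vectors_B_length[OF assms(1), of 1] assms(2) by simp
  moreover have "card (fixed_vectors 1 n \<sigma>) \<noteq> 0" using assms(2) by (intro notI) simp
  ultimately show ?thesis by simp
qed

lemma B_length_id [simp]: "B_length id = 0"
  by (rule B_length_eqI[OF id_in_B_perms[of 0]]) (simp add: card_fixed_vectors_id)

lemma B_length_signed_swap:
  assumes "\<tau> \<in> B_perms n" "i \<in> signed_range n" "j \<in> signed_range n" "i \<noteq> j" "\<tau> i = i"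
  shows "B_length (signed_swap i j \<circ> \<tau>) = Suc (B_length \<tau>)"
proof (rule B_length_eqI)
  show "signed_swap i j \<circ> \<tau> \<in> B_perms n"
    using assms by (intro B_perms_comp signed_swap_in_B_perms)
  show "card (fixed_vectors 1 n (signed_swap i j \<circ> \<tau>)) * 3 ^ Suc (B_length \<tau>) = 3 ^ n"
    using card_fixed_vectors_signed_swap[OF assms(1,2,4,5), of 1]
      card_fixed_vectors_B_length[OF assms(1), of 1] by simp
qed

lemma B_length_eq_0_iff:
  assumes "\<sigma> \<in> B_perms n" shows "B_length \<sigma> = 0 \<longleftrightarrow> \<sigma> = id"
  using ex_word_B_length[OF assms] by auto

lemma B_length_inv:
  assumes "\<sigma> \<in> B_perms n" shows "B_length (inv_into UNIV \<sigma>) = B_length \<sigma>"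
proof (rule B_length_eqI[OF B_perms_inv[OF assms]])
  have "\<sigma> permutes signed_range n" using assms by (simp add: B_perms_iff)
  then have "x \<circ> inv_into UNIV \<sigma> = x \<longleftrightarrow> x \<circ> \<sigma> = x" for x :: "int \<Rightarrow> int"
    using permutes_inv_o[of \<sigma>] by (metis o_assoc comp_id)
  then have "fixed_vectors 1 n (inv_into UNIV \<sigma>) = fixed_vectors 1 n \<sigma>" by (simp add: fixed_vectors_def)
  then show "card (fixed_vectors 1 n (inv_into UNIV \<sigma>)) * 3 ^ B_length \<sigma> = 3 ^ n"
    using card_fixed_vectors_B_length[OF assms, of 1] by simp
qed

text \<open>Induction on \<open>\<sigma>\<close>: the point \<open>i\<close> is moved by the swapped
  permutation, hence fixed by \<open>\<tau>\<close> and by \<open>\<rho> \<circ> \<tau>\<close>, so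
  the swap adds one to both sides.\<close>

lemma B_length_disjoint:
  assumes "\<sigma> \<in> B_perms n" "\<tau> \<in> B_perms n" "\<And>k. \<sigma> k = k \<or> \<tau> k = k"
  shows "B_length (\<sigma> \<circ> \<tau>) = B_length \<sigma> + B_length \<tau>"
  using assms(1,3)
proof (induction rule: B_perms_induct)
  case id
  show ?case by (metis id_comp B_length_id add_0)
next
  case (swap \<rho> i j)
  let ?s = "signed_swap i j \<circ> \<rho>"
  have nz: "i \<noteq> 0" "j \<noteq> 0" using swap by (auto simp: signed_range_iff)
  \<comment> \<open>Everything moved by \<open>\<rho>\<close> is still moved after the swap, so the
    disjointness hypothesis passes to \<open>\<rho>\<close>.\<close>
  have "?s k \<noteq> k" if "\<rho> k \<noteq> k" for k
  proof
    assume "?s k = k"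
    then have k: "\<rho> k = signed_swap i j k" using nz by (metis comp_apply signed_swap_invol)
    have "\<rho> (- i) = - i" using B_perms_minus[OF swap(1)] swap(4) by simp
    then have "k \<noteq> i" "k \<noteq> - i" "\<rho> k \<noteq> i" "\<rho> k \<noteq> - i"
      using that swap(4) B_perms_inj[OF swap(1)] by metis+
    then show False using k that by (auto simp: signed_swap_def split: if_splits)
  qed
  then have IH: "B_length (\<rho> \<circ> \<tau>) = B_length \<rho> + B_length \<tau>"
    using swap(6,7) by blast
  have "?s i \<noteq> i" using swap(4,5) by simp
  then have "\<tau> i = i" using swap(7) by blast
  then have "B_length (signed_swap i j \<circ> (\<rho> \<circ> \<tau>)) = Suc (B_length (\<rho> \<circ> \<tau>))"
    using swap assms(2) by (intro B_length_signed_swap[of _ n] B_perms_comp) auto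
  then show ?case using IH B_length_signed_swap[OF swap(1,2,3,5,4)] by (metis o_assoc add_Suc)
qed

text \<open>Conjugation by \<open>h\<close> carries the swap of \<open>i\<close> and
  \<open>j\<close> to that of \<open>h i\<close> and \<open>h j\<close>, and the fixed point
  \<open>i\<close> to \<open>h i\<close>. Each induction step therefore adds one on both
  sides.\<close>

lemma B_length_conj:
  assumes "\<sigma> \<in> B_perms n" "h \<in> B_perms n"
  shows "B_length (h \<circ> \<sigma> \<circ> inv_into UNIV h) = B_length \<sigma>"
  using assms(1)
proof (induction rule: B_perms_induct)
  case id
  have "h permutes signed_range n" using assms(2) by (simp add: B_perms_iff)
  then show ?case by (simp add: permutes_inv_o)
next
  case (swap \<rho> i j)
  let ?h = "inv_into UNIV h"
  have p: "h permutes signed_range n" using assms(2) by (simp add: B_perms_iff)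
  have eq: "h \<circ> signed_swap i j = signed_swap (h i) (h j) \<circ> h"
    using B_perms_inj[OF assms(2)] B_perms_minus[OF assms(2)]
    by (auto simp: fun_eq_iff signed_swap_def) metis+
  have "B_length (signed_swap (h i) (h j) \<circ> (h \<circ> \<rho> \<circ> ?h)) = Suc (B_length (h \<circ> \<rho> \<circ> ?h))"
  proof (rule B_length_signed_swap)
    show "h \<circ> \<rho> \<circ> ?h \<in> B_perms n"
      using swap assms(2) by (intro B_perms_comp B_perms_inv)
    show "h i \<in> signed_range n" "h j \<in> signed_range n" "h i \<noteq> h j"
      using swap B_perms_in_range[OF assms(2)] B_perms_inj[OF assms(2)] by auto
    show "(h \<circ> \<rho> \<circ> ?h) (h i) = h i" using swap(4) by (simp add: permutes_inverses[OF p])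
  qed
  moreover have "signed_swap (h i) (h j) \<circ> (h \<circ> \<rho> \<circ> ?h) = h \<circ> (signed_swap i j \<circ> \<rho>) \<circ> ?h"
    using eq by (metis o_assoc)
  ultimately show ?case using swap(6) B_length_signed_swap[OF swap(1,2,3,5,4)] by metis
qed

section \<open>Reflection length on \<open>D_inf\<close> and length generating functions\<close>

text \<open>
  A signed permutation that only changes signs is handled two coordinates at a time, since changing
  the signs of \<open>i\<close> and \<open>j\<close> is a product of two reflections of \<open>D_refl n\<close>.
\<close>

lemma ex_D_word_B_length:
  assumes "\<sigma> \<in> D_perms n"
  shows "\<exists>rs. set rs \<subseteq> D_refl n \<and> foldr (\<circ>) rs id = \<sigma> \<and> length rs = B_length \<sigma>"
  using assms
proof (induction "card {k. \<sigma> k \<noteq> k}" arbitrary: \<sigma> rule: less_induct)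
  case less
  have s: "\<sigma> \<in> B_perms n" using less.prems by (simp add: D_perms_def)
  consider "\<sigma> = id" | i where "\<sigma> i \<noteq> i" "\<sigma> i \<noteq> - i" | "\<sigma> \<noteq> id" "\<And>i. \<sigma> i = i \<or> \<sigma> i = - i"
    by blast
  then show "\<exists>rs. set rs \<subseteq> D_refl n \<and> foldr (\<circ>) rs id = \<sigma> \<and> length rs = B_length \<sigma>"
  proof cases
    case 1
    then show ?thesis by (intro exI[of _ "[]"]) simp
  next
    case (2 i)
    define \<tau> where "\<tau> = signed_swap i (\<sigma> i) \<circ> \<sigma>"
    note r = signed_swap_reduce[OF s 2(1), folded \<tau>_def]
    have "\<bar>i\<bar> \<noteq> \<bar>\<sigma> i\<bar>" using 2 by (metis abs_eq_iff)
    then have d: "signed_swap i (\<sigma> i) \<in> D_refl n" using r by (auto simp: D_refl_eq)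
    then have "\<tau> \<in> D_perms n" unfolding \<tau>_def using less.prems D_refl_subset by (blast intro: D_perms_comp)
    with less.hyps psubset_card_mono[OF finite_moved[OF s] r(6)] obtain rs where
      rs: "set rs \<subseteq> D_refl n" "foldr (\<circ>) rs id = \<tau>" "length rs = B_length \<tau>"
      by blast
    have "B_length \<sigma> = Suc (B_length \<tau>)"
      using B_length_signed_swap[OF r(1,3,4) _ r(2)] 2 r(5) by metis
    then show ?thesis using rs d r(5) by (intro exI[of _ "signed_swap i (\<sigma> i) # rs"]) simp
  next
    case 3
    let ?S = "{k \<in> {1..int n}. \<sigma> k < 0}"
    obtain k where k: "\<sigma> k \<noteq> k" using 3(1) by (auto simp: fun_eq_iff)
    then have "\<sigma> k = - k" "k \<in> signed_range n" using 3(2) B_perms_outside[OF s] by blast+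
    then have "\<bar>k\<bar> \<in> ?S" using B_perms_minus[OF s, of k] by (auto simp: signed_range_iff abs_if)
    then have "?S \<noteq> {}" by blast
    have "finite ?S" by (rule finite_subset[of _ "{1..int n}"]) auto
    with \<open>?S \<noteq> {}\<close> have "card ?S \<noteq> 0" by simp
    \<comment> \<open>Membership in \<open>D_perms n\<close> enters here: a nonzero even number of
      negated coordinates supplies a second one.\<close>
    moreover have "even (card ?S)" using less.prems by (simp add: D_perms_def)
    ultimately have "2 \<le> card ?S" by presburger
    then obtain i j where ij: "i \<in> ?S" "j \<in> ?S" "i \<noteq> j"
      by (metis (no_types, lifting) card_le_Suc0_iff_eq[OF \<open>finite ?S\<close>] not_less_eq_eq numeral_2_eq_2)
    then have pos: "i > 0" "j > 0" by auto
    have neq: "- i \<noteq> j" "- j \<noteq> i" "i \<noteq> - j" "j \<noteq> - i" "- i \<noteq> i" "- j \<noteq> j" "i \<noteq> - i" "j \<noteq> - j" "i \<noteq> j" "j \<noteq> i"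
      using pos ij(3) by auto
    have mij: "\<sigma> i = - i" "\<sigma> j = - j" using 3(2)[of i] 3(2)[of j] ij by auto
    define \<rho> where "\<rho> = signed_swap i (\<sigma> i) \<circ> \<sigma>"
    have "\<sigma> i \<noteq> i" using mij neq by simp
    note r = signed_swap_reduce[OF s this, folded \<rho>_def]
    have rj: "\<rho> j = - j" using neq by (simp add: \<rho>_def mij signed_swap_def)
    define \<tau> where "\<tau> = signed_swap j (\<rho> j) \<circ> \<rho>"
    have "\<rho> j \<noteq> j" using rj neq by simp
    note t = signed_swap_reduce[OF r(1) this, folded \<tau>_def]
    have "signed_swap j (- j) \<circ> signed_swap i (- i) = signed_swap i j \<circ> signed_swap i (- j)"
    proof
      fix k
      have nz: "i \<noteq> 0" "j \<noteq> 0" using pos by auto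
      consider "k = i" | "k = - i" | "k = j" | "k = - j" | "k \<noteq> i" "k \<noteq> - i" "k \<noteq> j" "k \<noteq> - j"
        by blast
      then show "(signed_swap j (- j) \<circ> signed_swap i (- i)) k = (signed_swap i j \<circ> signed_swap i (- j)) k"
        by cases (simp_all add: signed_swap_def neq nz)
    qed
    then have tau: "\<tau> = signed_swap i j \<circ> (signed_swap i (- j) \<circ> \<sigma>)"
      unfolding \<tau>_def rj unfolding \<rho>_def mij o_assoc by (rule arg_cong)
    have rng: "i \<in> signed_range n" "j \<in> signed_range n" "- j \<in> signed_range n"
      using ij by (auto simp: signed_range_iff)
    have "\<bar>i\<bar> \<noteq> \<bar>j\<bar>" using pos ij(3) by simp
    then have d: "signed_swap i j \<in> D_refl n" "signed_swap i (- j) \<in> D_refl n"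
      using rng by (fastforce simp: D_refl_eq)+
    then have "\<tau> \<in> D_perms n" unfolding tau using less.prems D_refl_subset by (blast intro: D_perms_comp)
    moreover have "card {k. \<tau> k \<noteq> k} < card {k. \<sigma> k \<noteq> k}"
      using psubset_card_mono[OF finite_moved[OF s] psubset_trans[OF t(6) r(6)]] .
    ultimately obtain rs where
      rs: "set rs \<subseteq> D_refl n" "foldr (\<circ>) rs id = \<tau>" "length rs = B_length \<tau>"
      using less.hyps by blast
    \<comment> \<open>Two sign changes are removed and two reflections of \<open>D_refl n\<close>
      are prepended, so word length and \<open>B_length\<close> grow equally.\<close>
    have "B_length \<rho> = Suc (B_length \<tau>)"
      using B_length_signed_swap[OF t(1,3,4) _ t(2)] \<open>\<rho> j \<noteq> j\<close> t(5) by metis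
    moreover have "B_length \<sigma> = Suc (B_length \<rho>)"
      using B_length_signed_swap[OF r(1,3,4) _ r(2)] \<open>\<sigma> i \<noteq> i\<close> r(5) by metis
    moreover have "signed_swap i (- j) \<circ> (signed_swap i j \<circ> \<tau>) = \<sigma>"
      unfolding tau using pos by simp
    ultimately show ?thesis using rs d
      by (intro exI[of _ "signed_swap i (- j) # signed_swap i j # rs"]) simp
  qed
qed

text \<open>Every word over the reflections of type D is one over those of type B, which gives one
  inequality; \<open>ex_D_word_B_length\<close> gives the other.\<close>

lemma D_length_eq_B_length:
  assumes "\<sigma> \<in> D_perms n" shows "D_length \<sigma> = B_length \<sigma>"
proof -
  have s: "\<sigma> \<in> B_perms n" using assms by (simp add: D_perms_def)
  show ?thesis
    unfolding D_length_def word_length_def D_inf_def monoid.select_convs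
  proof (rule Least_equality)
    show "\<exists>rs. length rs = B_length \<sigma> \<and> set rs \<subseteq> (\<Union>n. D_refl n) \<and> foldr (\<circ>) rs id = \<sigma>"
      using ex_D_word_B_length[OF assms] by blast
  next
    fix k assume "\<exists>rs. length rs = k \<and> set rs \<subseteq> (\<Union>n. D_refl n) \<and> foldr (\<circ>) rs id = \<sigma>"
    then obtain rs where rs: "length rs = k" "set rs \<subseteq> (\<Union>n. D_refl n)" "foldr (\<circ>) rs id = \<sigma>"
      by blast
    then have "set rs \<subseteq> (\<Union>n. B_refl n)" using D_refl_subset_B_refl by blast
    then show "B_length \<sigma> \<le> k" using B_length_le[OF s _ rs(3)] rs(1) by simp
  qed
qed

section \<open>The determinant and the parity of the reflection length\<close>

definition abs_perm :: "(int \<Rightarrow> int) \<Rightarrow> int \<Rightarrow> int"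
  where "abs_perm \<sigma> k = (if k > 0 then \<bar>\<sigma> k\<bar> else k)"

lemma abs_perm_id: "abs_perm id = id"
  by (auto simp: abs_perm_def)

lemma abs_perm_comp:
  assumes "\<sigma> \<in> B_perms n" "\<tau> \<in> B_perms n"
  shows "abs_perm (\<sigma> \<circ> \<tau>) = abs_perm \<sigma> \<circ> abs_perm \<tau>"
proof
  fix k
  have "\<tau> k \<noteq> 0" if "k > 0"
    using B_perms_inj[OF assms(2), of k 0] B_perms_minus[OF assms(2), of 0] that by auto
  moreover have "\<bar>\<sigma> \<bar>\<tau> k\<bar>\<bar> = \<bar>\<sigma> (\<tau> k)\<bar>"
    using B_perms_minus[OF assms(1), of "\<tau> k"] by (simp add: abs_if)
  ultimately show "abs_perm (\<sigma> \<circ> \<tau>) k = (abs_perm \<sigma> \<circ> abs_perm \<tau>) k"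
    by (simp add: abs_perm_def)
qed

text \<open>Forgetting signs is compatible with composition and inverses. Keeping nonpositive
  integers fixed makes the image a permutation of all of \<open>int\<close>, so that
  \<open>sign\<close> applies to it.\<close>

lemma permutation_abs_perm:
  assumes s: "\<sigma> \<in> B_perms n" shows "permutation (abs_perm \<sigma>)"
  unfolding permutation
proof
  let ?i = "inv_into UNIV \<sigma>"
  have p: "\<sigma> permutes signed_range n" using s by (simp add: B_perms_iff)
  have "abs_perm \<sigma> \<circ> abs_perm ?i = id" "abs_perm ?i \<circ> abs_perm \<sigma> = id"
    using abs_perm_comp[OF s B_perms_inv[OF s]] abs_perm_comp[OF B_perms_inv[OF s] s]
    by (simp_all add: permutes_inv_o[OF p] abs_perm_id)
  then show "bij (abs_perm \<sigma>)" by (rule o_bij[rotated])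
  show "finite {k. abs_perm \<sigma> k \<noteq> k}"
    by (rule finite_subset[OF _ finite_moved[OF s]]) (auto simp: abs_perm_def)
qed

lemma abs_perm_signed_swap:
  assumes "i \<noteq> 0" "j \<noteq> 0" shows "abs_perm (signed_swap i j) = transpose \<bar>i\<bar> \<bar>j\<bar>"
proof
  fix k show "abs_perm (signed_swap i j) k = transpose \<bar>i\<bar> \<bar>j\<bar> k"
    using assms unfolding abs_perm_def signed_swap_def transpose_def by (cases "i > 0"; cases "j > 0") auto
qed

text \<open>The reflection length has the parity of the determinant of the signed permutation matrix.\<close>

lemma minus_one_power_B_length:
  assumes "\<sigma> \<in> B_perms n"
  shows "(- 1) ^ B_length \<sigma> = sign (abs_perm \<sigma>) * (\<Prod>k=1..int n. sgn (\<sigma> k))"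
  using assms
proof (induction rule: B_perms_induct)
  case id
  have "(\<Prod>k=1..int n. sgn k) = 1" by (rule prod.neutral) simp
  then show "(- 1) ^ B_length id = sign (abs_perm id) * (\<Prod>k=1..int n. sgn (id k))"
    by (simp add: abs_perm_id sign_id)
next
  case (swap \<tau> i j)
  have nz: "i \<noteq> 0" "j \<noteq> 0" using swap by (auto simp: signed_range_iff)
  have r: "signed_swap i j \<in> B_perms n" using swap by (intro signed_swap_in_B_perms)
  \<comment> \<open>A reflection has determinant -1: either a transposition with trivial sign
    product, or, for \<open>j = - i\<close>, the trivial permutation with a single sign
    change.\<close>
  have "sign (abs_perm (signed_swap i j)) * (\<Prod>k=1..int n. sgn (signed_swap i j k)) = - 1"
    using prod_sgn_signed_swap[OF swap(2,3,5)] swap(5) nz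
    by (auto simp: abs_perm_signed_swap sign_swap_id abs_eq_iff)
  moreover have "sign (abs_perm (signed_swap i j \<circ> \<tau>)) = sign (abs_perm (signed_swap i j)) * sign (abs_perm \<tau>)"
    unfolding abs_perm_comp[OF r swap(1)]
    by (intro sign_compose permutation_abs_perm[OF r] permutation_abs_perm[OF swap(1)])
  ultimately have "sign (abs_perm (signed_swap i j \<circ> \<tau>)) * (\<Prod>k=1..int n. sgn ((signed_swap i j \<circ> \<tau>) k)) =
      - (sign (abs_perm \<tau>) * (\<Prod>k=1..int n. sgn (\<tau> k)))"
    unfolding sgn_prod_comp[OF r swap(1)] by (metis (no_types, lifting) mult.assoc mult.left_commute mult_minus1)
  then show "(- 1) ^ B_length (signed_swap i j \<circ> \<tau>) =
      sign (abs_perm (signed_swap i j \<circ> \<tau>)) * (\<Prod>k=1..int n. sgn ((signed_swap i j \<circ> \<tau>) k))"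
    using swap(6) unfolding B_length_signed_swap[OF swap(1,2,3,5,4)] by simp
qed

lemma minus_one_power_B_length_comp:
  assumes "\<sigma> \<in> B_perms n" "\<tau> \<in> B_perms n"
  shows "(- 1 :: 'a :: ring_1) ^ B_length (\<sigma> \<circ> \<tau>) = (- 1) ^ B_length \<sigma> * (- 1) ^ B_length \<tau>"
proof -
  have "sign (abs_perm (\<sigma> \<circ> \<tau>)) = sign (abs_perm \<sigma>) * sign (abs_perm \<tau>)"
    unfolding abs_perm_comp[OF assms]
    by (intro sign_compose permutation_abs_perm[OF assms(1)] permutation_abs_perm[OF assms(2)])
  then have "(- 1 :: int) ^ B_length (\<sigma> \<circ> \<tau>) = (- 1) ^ B_length \<sigma> * (- 1) ^ B_length \<tau>"
    using minus_one_power_B_length[OF assms(1)] minus_one_power_B_length[OF assms(2)]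
      minus_one_power_B_length[OF B_perms_comp[OF assms]] sgn_prod_comp[OF assms]
    by (simp add: mult_ac)
  then have "of_int ((- 1) ^ B_length (\<sigma> \<circ> \<tau>)) = (of_int ((- 1) ^ B_length \<sigma> * (- 1) ^ B_length \<tau>) :: 'a)"
    by (rule arg_cong)
  then show ?thesis by simp
qed

section \<open>Generating functions of the reflection length\<close>

lemma finite_B_perms [simp]: "finite (B_perms n)"
  by (rule finite_subset[OF _ finite_permutations[OF finite_signed_range[of n]]])
     (auto simp: B_perms_def)

lemma B_perms_0: "B_perms 0 = {id}"
  by (auto simp: B_perms_iff signed_range_def)

lemma B_perms_Suc_fixing:
  assumes t: "\<tau> \<in> B_perms (Suc n)" and f: "\<tau> (int (Suc n)) = int (Suc n)"
  shows "\<tau> \<in> B_perms n"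
proof -
  have "\<tau> permutes signed_range n"
  proof (rule permutes_superset)
    show "\<tau> permutes signed_range (Suc n)" using t by (simp add: B_perms_iff)
    fix k assume "k \<in> signed_range (Suc n) - signed_range n"
    then have "k = int (Suc n) \<or> k = - int (Suc n)" by (auto simp: signed_range_iff)
    then show "\<tau> k = k" using f B_perms_minus[OF t, of "int (Suc n)"] by metis
  qed
  then show ?thesis using B_perms_minus[OF t] by (simp add: B_perms_iff)
qed

text \<open>Coset decomposition: \<open>\<sigma>\<close> is recovered from the image
  \<open>j\<close> of the last coordinate and the element of \<open>B_perms n\<close> that remains
  after swapping \<open>j\<close> back.\<close>

lemma sum_B_perms_Suc:
  "(\<Sum>\<sigma>\<in>B_perms (Suc n). f \<sigma>) =
    (\<Sum>j\<in>signed_range (Suc n). \<Sum>\<tau>\<in>B_perms n. f (signed_swap (int (Suc n)) j \<circ> \<tau>))"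
proof -
  let ?m = "int (Suc n)"
  have m: "?m \<in> signed_range (Suc n)" by (auto simp: signed_range_iff)
  have fix_m: "\<tau> ?m = ?m" if "\<tau> \<in> B_perms n" for \<tau>
    by (rule B_perms_outside[OF that]) (auto simp: signed_range_iff)
  have "bij_betw (\<lambda>(j, \<tau>). signed_swap ?m j \<circ> \<tau>) (signed_range (Suc n) \<times> B_perms n) (B_perms (Suc n))"
  proof (rule bij_betw_byWitness[where f' = "\<lambda>\<sigma>. (\<sigma> ?m, signed_swap ?m (\<sigma> ?m) \<circ> \<sigma>)"])
    show "\<forall>p\<in>signed_range (Suc n) \<times> B_perms n.
        (\<lambda>\<sigma>. (\<sigma> ?m, signed_swap ?m (\<sigma> ?m) \<circ> \<sigma>)) (case p of (j, \<tau>) \<Rightarrow> signed_swap ?m j \<circ> \<tau>) = p"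
    proof
      fix p assume "p \<in> signed_range (Suc n) \<times> B_perms n"
      then obtain j \<tau> where p: "p = (j, \<tau>)" "j \<noteq> 0" "\<tau> \<in> B_perms n" by (auto simp: signed_range_iff)
      have "(signed_swap ?m j \<circ> \<tau>) ?m = j" unfolding comp_apply fix_m[OF p(3)] by simp
      then show "(\<lambda>\<sigma>. (\<sigma> ?m, signed_swap ?m (\<sigma> ?m) \<circ> \<sigma>)) (case p of (j, \<tau>) \<Rightarrow> signed_swap ?m j \<circ> \<tau>) = p"
        unfolding p(1) case_prod_conv using p(2) by (metis of_nat_neq_0 signed_swap_comp)
    qed
    show "\<forall>\<sigma>\<in>B_perms (Suc n). (case (\<sigma> ?m, signed_swap ?m (\<sigma> ?m) \<circ> \<sigma>) of
        (j, \<tau>) \<Rightarrow> signed_swap ?m j \<circ> \<tau>) = \<sigma>"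
    proof
      fix \<sigma> assume "\<sigma> \<in> B_perms (Suc n)"
      then have "\<sigma> ?m \<in> signed_range (Suc n)" using B_perms_in_range m by blast
      then show "(case (\<sigma> ?m, signed_swap ?m (\<sigma> ?m) \<circ> \<sigma>) of (j, \<tau>) \<Rightarrow> signed_swap ?m j \<circ> \<tau>) = \<sigma>"
        by (simp add: signed_range_iff)
    qed
    show "(\<lambda>(j, \<tau>). signed_swap ?m j \<circ> \<tau>) ` (signed_range (Suc n) \<times> B_perms n) \<subseteq> B_perms (Suc n)"
      using B_perms_mono[of n "Suc n"] m by (auto intro!: B_perms_comp signed_swap_in_B_perms)
    show "(\<lambda>\<sigma>. (\<sigma> ?m, signed_swap ?m (\<sigma> ?m) \<circ> \<sigma>)) ` B_perms (Suc n) \<subseteq> signed_range (Suc n) \<times> B_perms n"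
    proof clarify
      fix \<sigma> assume s: "\<sigma> \<in> B_perms (Suc n)"
      then have "\<sigma> ?m \<in> signed_range (Suc n)" using B_perms_in_range m by blast
      moreover from this have "signed_swap ?m (\<sigma> ?m) \<circ> \<sigma> \<in> B_perms n"
        using s m by (intro B_perms_Suc_fixing[OF B_perms_comp[OF signed_swap_in_B_perms]]) simp_all
      ultimately show "\<sigma> ?m \<in> signed_range (Suc n) \<and> signed_swap ?m (\<sigma> ?m) \<circ> \<sigma> \<in> B_perms n" ..
    qed
  qed
  from sum.reindex_bij_betw[OF this, of f, symmetric]
  have "(\<Sum>\<sigma>\<in>B_perms (Suc n). f \<sigma>) =
      (\<Sum>(j, \<tau>)\<in>signed_range (Suc n) \<times> B_perms n. f (signed_swap ?m j \<circ> \<tau>))"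
    by (simp add: case_prod_unfold)
  then show ?thesis by (simp add: sum.cartesian_product)
qed

text \<open>Treats the trivial weight (\<open>c = 1\<close>) and the sign product
  (\<open>c = - 1\<close>) together. Among the coset representatives the identity contributes 1, the
  sign change \<open>c * p\<close>, and each of the other \<open>2 * n\<close> swaps
  \<open>p\<close>.\<close>

lemma sum_B_perms_Suc_twisted:
  fixes p :: "'a :: comm_ring_1"
  assumes id: "\<And>\<tau>. \<tau> \<in> B_perms n \<Longrightarrow> u (Suc n) \<tau> = u n \<tau>"
    and swap: "\<And>\<tau> j. \<tau> \<in> B_perms n \<Longrightarrow> j \<in> signed_range (Suc n) \<Longrightarrow> j \<noteq> int (Suc n) \<Longrightarrow>
      u (Suc n) (signed_swap (int (Suc n)) j \<circ> \<tau>) = (if j = - int (Suc n) then c else 1) * u n \<tau>"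
  shows "(\<Sum>\<sigma>\<in>B_perms (Suc n). u (Suc n) \<sigma> * p ^ B_length \<sigma>) =
    (1 + (2 * of_nat n + c) * p) * (\<Sum>\<tau>\<in>B_perms n. u n \<tau> * p ^ B_length \<tau>)"
proof -
  let ?m = "int (Suc n)"
  let ?S = "\<Sum>\<tau>\<in>B_perms n. u n \<tau> * p ^ B_length \<tau>"
  define w where "w j = (if j = ?m then 1 else if j = - ?m then c * p else p)" for j
  have "(\<Sum>\<tau>\<in>B_perms n. u (Suc n) (signed_swap ?m j \<circ> \<tau>) * p ^ B_length (signed_swap ?m j \<circ> \<tau>)) = w j * ?S"
    if j: "j \<in> signed_range (Suc n)" for j
    unfolding sum_distrib_left
  proof (rule sum.cong[OF refl])
    fix \<tau> assume t: "\<tau> \<in> B_perms n"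
    show "u (Suc n) (signed_swap ?m j \<circ> \<tau>) * p ^ B_length (signed_swap ?m j \<circ> \<tau>) =
        w j * (u n \<tau> * p ^ B_length \<tau>)"
    proof (cases "j = ?m")
      case True
      have "signed_swap ?m ?m = id" by (auto simp: signed_swap_def)
      then show ?thesis unfolding True using id[OF t] by (simp add: w_def)
    next
      case False
      have "\<tau> ?m = ?m" by (rule B_perms_outside[OF t]) (auto simp: signed_range_iff)
      moreover have "?m \<in> signed_range (Suc n)" by (auto simp: signed_range_iff)
      ultimately have "B_length (signed_swap ?m j \<circ> \<tau>) = Suc (B_length \<tau>)"
        using B_perms_mono[of n "Suc n"] t False j by (intro B_length_signed_swap[of _ "Suc n"]) auto
      then show ?thesis using swap[OF t j False] False by (simp add: w_def mult_ac)
    qed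
  qed
  then have "(\<Sum>\<sigma>\<in>B_perms (Suc n). u (Suc n) \<sigma> * p ^ B_length \<sigma>) = (\<Sum>j\<in>signed_range (Suc n). w j * ?S)"
    unfolding sum_B_perms_Suc by (rule sum.cong[OF refl])
  also have "\<dots> = (\<Sum>j\<in>signed_range (Suc n). w j) * ?S" by (simp add: sum_distrib_right)
  also have "(\<Sum>j\<in>signed_range (Suc n). w j) = 1 + (2 * of_nat n + c) * p"
  proof -
    have *: "signed_range (Suc n) = insert ?m (insert (- ?m) (signed_range n))"
      by (auto simp: signed_range_iff)
    have "(\<Sum>j\<in>signed_range n. w j) = (\<Sum>j\<in>signed_range n. p)"
      by (rule sum.cong) (auto simp: w_def signed_range_iff)
    moreover have "card (signed_range n) = 2 * n"
      by (auto simp: signed_range_def nat_add_distrib nat_mult_distrib)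
    moreover have "?m \<notin> insert (- ?m) (signed_range n)" "- ?m \<notin> signed_range n"
      by (auto simp: signed_range_iff)
    ultimately show ?thesis unfolding * by (simp add: w_def algebra_simps)
  qed
  finally show ?thesis .
qed

lemma sum_power_B_length:
  "(\<Sum>\<sigma>\<in>B_perms n. p ^ B_length \<sigma>) = (\<Prod>k<n. 1 + (2 * of_nat k + 1) * p :: 'a :: comm_ring_1)"
proof (induction n)
  case 0
  show "(\<Sum>\<sigma>\<in>B_perms 0. p ^ B_length \<sigma>) = (\<Prod>k<0. 1 + (2 * of_nat k + 1) * p)"
    by (simp add: B_perms_0)
next
  case (Suc n)
  show ?case using sum_B_perms_Suc_twisted[of n "\<lambda>_ _. 1" 1 p] Suc by (simp add: mult_ac)
qed

lemma sum_sgn_power_B_length: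
  "(\<Sum>\<sigma>\<in>B_perms n. of_int (\<Prod>k=1..int n. sgn (\<sigma> k)) * p ^ B_length \<sigma>) =
    (\<Prod>k<n. 1 + (2 * of_nat k - 1) * p :: 'a :: comm_ring_1)"
proof (induction n)
  case 0
  show "(\<Sum>\<sigma>\<in>B_perms 0. of_int (\<Prod>k=1..int 0. sgn (\<sigma> k)) * p ^ B_length \<sigma>) =
      (\<Prod>k<0. 1 + (2 * of_nat k - 1) * p)"
    by (simp add: B_perms_0)
next
  case (Suc n)
  let ?m = "int (Suc n)"
  define u :: "nat \<Rightarrow> (int \<Rightarrow> int) \<Rightarrow> 'a"
    where "u n \<sigma> = of_int (\<Prod>k=1..int n. sgn (\<sigma> k))" for n \<sigma>
  have id: "u (Suc n) \<tau> = u n \<tau>" if "\<tau> \<in> B_perms n" for \<tau>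
  proof -
    have "\<tau> ?m = ?m" by (rule B_perms_outside[OF that]) (auto simp: signed_range_iff)
    moreover have "{1..?m} = insert ?m {1..int n}" by auto
    ultimately show ?thesis by (simp add: u_def)
  qed
  have "u (Suc n) (signed_swap ?m j \<circ> \<tau>) = (if j = - ?m then - 1 else 1) * u n \<tau>"
    if t: "\<tau> \<in> B_perms n" and j: "j \<in> signed_range (Suc n)" "j \<noteq> ?m" for \<tau> j
  proof -
    have m: "?m \<in> signed_range (Suc n)" by (auto simp: signed_range_iff)
    have "\<tau> \<in> B_perms (Suc n)" using B_perms_mono[of n "Suc n"] t by auto
    then have "u (Suc n) (signed_swap ?m j \<circ> \<tau>) = u (Suc n) (signed_swap ?m j) * u (Suc n) \<tau>"
      unfolding u_def of_int_mult[symmetric]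
      by (subst sgn_prod_comp) (use m j in \<open>auto intro: signed_swap_in_B_perms\<close>)
    moreover have "u (Suc n) (signed_swap ?m j) = (if j = - ?m then - 1 else 1)"
      unfolding u_def prod_sgn_signed_swap[OF m j(1) j(2)[symmetric]] by simp
    ultimately show ?thesis using id[OF t] by simp
  qed
  from sum_B_perms_Suc_twisted[of n u, OF id this, of p]
  show ?case using Suc by (simp add: u_def mult_ac)
qed

text \<open>Half of 1 plus the sign product is the indicator of \<open>D_perms\<close> inside
  \<open>B_perms\<close>, so the sum is the mean of the two sums over
  \<open>B_perms\<close>.\<close>

lemma sum_power_B_length_D_perms:
  fixes p :: real
  shows "(\<Sum>\<sigma>\<in>D_perms (Suc m). p ^ B_length \<sigma>) = (\<Prod>k<m. 1 + (2 * real k + 1) * p) * (1 + real m * p)"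
proof -
  let ?n = "Suc m"
  have *: "(of_int (\<Prod>k=1..int ?n. sgn (\<sigma> k)) + 1) / 2 = (of_bool (\<sigma> \<in> D_perms ?n) :: real)"
    if "\<sigma> \<in> B_perms ?n" for \<sigma>
  proof -
    have "\<sigma> k \<noteq> 0" if "k \<in> {1..int ?n}" for k
      using B_perms_in_range[OF \<open>\<sigma> \<in> B_perms ?n\<close>, of k] that by (auto simp: signed_range_iff)
    then have "(\<Prod>k=1..int ?n. sgn (\<sigma> k))\<^sup>2 = 1"
      unfolding prod_power_distrib by (intro prod.neutral ballI) (simp add: sgn_if)
    then have "(\<Prod>k=1..int ?n. sgn (\<sigma> k)) = 1 \<or> (\<Prod>k=1..int ?n. sgn (\<sigma> k)) = - 1"
      by (rule power2_eq_1_iff[THEN iffD1])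
    then show ?thesis using that unfolding D_perms_iff by (auto simp del: of_int_prod of_nat_Suc)
  qed
  have "(\<Sum>\<sigma>\<in>D_perms ?n. p ^ B_length \<sigma>) = (\<Sum>\<sigma>\<in>B_perms ?n. of_bool (\<sigma> \<in> D_perms ?n) * p ^ B_length \<sigma>)"
    by (intro sum.mono_neutral_cong_left) (auto simp: D_perms_def)
  also have "\<dots> = (\<Sum>\<sigma>\<in>B_perms ?n. (of_int (\<Prod>k=1..int ?n. sgn (\<sigma> k)) + 1) / 2 * p ^ B_length \<sigma>)"
    using * by (intro sum.cong) auto
  also have "\<dots> = ((\<Sum>\<sigma>\<in>B_perms ?n. of_int (\<Prod>k=1..int ?n. sgn (\<sigma> k)) * p ^ B_length \<sigma>) +
      (\<Sum>\<sigma>\<in>B_perms ?n. p ^ B_length \<sigma>)) / 2"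
    by (simp add: sum.distrib sum_divide_distrib add_divide_distrib distrib_right)
  also have "\<dots> = ((\<Prod>k<?n. 1 + (2 * real k - 1) * p) + (\<Prod>k<?n. 1 + (2 * real k + 1) * p)) / 2"
    unfolding sum_power_B_length sum_sgn_power_B_length ..
  \<comment> \<open>An index shift exposes the product common to both terms. What remains is the
    mean of \<open>1 - p\<close> and \<open>1 + (2 * m + 1) * p\<close>, which is
    \<open>1 + m * p\<close>.\<close>
  also have "(\<Prod>k<?n. 1 + (2 * real k - 1) * p) = (1 - p) * (\<Prod>k<m. 1 + (2 * real k + 1) * p)"
    unfolding prod.lessThan_Suc_shift by (simp add: algebra_simps)
  finally show ?thesis by (simp add: field_simps)
qed

section \<open>Positive definite functions and extreme characters\<close>

lemma sum_in_nonneg_Reals: "(\<And>x. x \<in> A \<Longrightarrow> f x \<in> \<real>\<^sub>\<ge>\<^sub>0) \<Longrightarrow> sum f A \<in> \<real>\<^sub>\<ge>\<^sub>0"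
  by (induction A rule: infinite_finite_induct) (auto intro: nonneg_Reals_add_I)

text \<open>Grouping the indices by the value of \<open>a\<close> turns the form into a sum of
  squared moduli of the group totals \<open>w y\<close>.\<close>

lemma of_bool_eq_kernel_nonneg:
  fixes z :: "'i \<Rightarrow> complex"
  assumes "finite I"
  shows "(\<Sum>i\<in>I. \<Sum>j\<in>I. z i * cnj (z j) * of_bool (a i = a j)) \<in> \<real>\<^sub>\<ge>\<^sub>0"
proof -
  define w where "w y = (\<Sum>i\<in>I. z i * of_bool (a i = y))" for y
  have "of_bool (a i = a j) = (\<Sum>y\<in>a ` I. of_bool (a i = y) * of_bool (a j = y) :: complex)"
    if "i \<in> I" for i j
  proof -
    have "(\<Sum>y\<in>a ` I. of_bool (a i = y) * of_bool (a j = y) :: complex) =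
        (\<Sum>y\<in>{a i}. of_bool (a i = y) * of_bool (a j = y))"
      using assms that by (intro sum.mono_neutral_right) auto
    then show ?thesis by auto
  qed
  then have "(\<Sum>i\<in>I. \<Sum>j\<in>I. z i * cnj (z j) * of_bool (a i = a j)) =
      (\<Sum>i\<in>I. \<Sum>j\<in>I. \<Sum>y\<in>a ` I. (z i * of_bool (a i = y)) * (cnj (z j) * of_bool (a j = y)))"
    by (intro sum.cong refl) (simp add: sum_distrib_left mult_ac)
  also have "\<dots> = (\<Sum>i\<in>I. \<Sum>y\<in>a ` I. \<Sum>j\<in>I. (z i * of_bool (a i = y)) * (cnj (z j) * of_bool (a j = y)))"
    by (intro sum.cong refl sum.swap)
  also have "\<dots> = (\<Sum>y\<in>a ` I. \<Sum>i\<in>I. \<Sum>j\<in>I. (z i * of_bool (a i = y)) * (cnj (z j) * of_bool (a j = y)))"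
    by (rule sum.swap)
  also have "\<dots> = (\<Sum>y\<in>a ` I. w y * cnj (w y))"
    unfolding w_def cnj_sum sum_product by (intro sum.cong refl) simp
  also have "\<dots> = of_real (\<Sum>y\<in>a ` I. (cmod (w y))\<^sup>2)"
    by (simp only: of_real_sum complex_norm_square)
  also have "\<dots> \<in> \<real>\<^sub>\<ge>\<^sub>0"
    unfolding nonneg_Reals_of_real_iff by (intro sum_nonneg) simp
  finally show ?thesis .
qed

text \<open>Reindexing to arbitrary finite index sets, so that Booleans or the group elements
  themselves can serve as indices.\<close>

lemma positive_definite_sum_nonneg:
  assumes "positive_definite G \<phi>" "finite I" "\<And>i. i \<in> I \<Longrightarrow> g i \<in> carrier G"
  shows "(\<Sum>i\<in>I. \<Sum>j\<in>I. z i * cnj (z j) * \<phi> (inv\<^bsub>G\<^esub> g j \<otimes>\<^bsub>G\<^esub> g i)) \<in> \<real>\<^sub>\<ge>\<^sub>0"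
proof (cases "I = {}")
  case False
  obtain h where h: "bij_betw h {1..card I} I" using ex_bij_betw_nat_finite_1[OF assms(2)] by blast
  have "card I \<ge> 1" using False assms(2) by (simp add: Suc_le_eq card_gt_0_iff)
  moreover have "\<forall>i\<in>{1..card I}. g (h i) \<in> carrier G" using h assms(3) by (auto simp: bij_betw_def)
  ultimately have "(\<Sum>i=1..card I. \<Sum>j=1..card I.
      z (h i) * cnj (z (h j)) * \<phi> (inv\<^bsub>G\<^esub> g (h j) \<otimes>\<^bsub>G\<^esub> g (h i))) \<in> \<real>\<^sub>\<ge>\<^sub>0"
    using assms(1)[unfolded positive_definite_def, rule_format, of "card I" "\<lambda>i. g (h i)" "\<lambda>i. z (h i)"]
    by blast
  also have "(\<Sum>i=1..card I. \<Sum>j=1..card I. z (h i) * cnj (z (h j)) * \<phi> (inv\<^bsub>G\<^esub> g (h j) \<otimes>\<^bsub>G\<^esub> g (h i))) =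
      (\<Sum>i=1..card I. \<Sum>j\<in>I. z (h i) * cnj (z j) * \<phi> (inv\<^bsub>G\<^esub> g j \<otimes>\<^bsub>G\<^esub> g (h i)))"
    by (intro sum.cong refl sum.reindex_bij_betw[OF h])
  also have "\<dots> = (\<Sum>i\<in>I. \<Sum>j\<in>I. z i * cnj (z j) * \<phi> (inv\<^bsub>G\<^esub> g j \<otimes>\<^bsub>G\<^esub> g i))"
    by (rule sum.reindex_bij_betw[OF h])
  finally show ?thesis .
qed simp

lemma (in group) character_inv:
  assumes "group_character G \<chi>" "g \<in> carrier G"
  shows "\<chi> (inv g) = cnj (\<chi> g)"
proof -
  have pd: "positive_definite G \<chi>" and one: "\<chi> \<one> = 1" using assms(1) by (auto simp: group_character_def)
  have *: "1 + cnj w * \<chi> (inv g) + w * \<chi> g + w * cnj w \<in> \<real>\<^sub>\<ge>\<^sub>0" for w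
  proof -
    have "(\<Sum>i\<in>{False, True}. \<Sum>j\<in>{False, True}. (if i then w else 1) * cnj (if j then w else 1) *
        \<chi> (inv (if j then g else \<one>) \<otimes> (if i then g else \<one>))) \<in> \<real>\<^sub>\<ge>\<^sub>0"
      using assms(2) by (intro positive_definite_sum_nonneg[OF pd]) auto
    then show ?thesis using assms(2) by (simp add: one add_ac)
  qed
  \<comment> \<open>Reality of the form for the weights 1 and \<open>\<i>\<close> on
    \<open>g\<close> determines the imaginary and the real part in turn.\<close>
  have "Im (\<chi> (inv g)) = - Im (\<chi> g)"
    using *[of 1] by (simp add: complex_nonneg_Reals_iff)
  moreover have "Re (\<chi> (inv g)) = Re (\<chi> g)"
    using *[of \<i>] by (simp add: complex_nonneg_Reals_iff)
  ultimately show ?thesis by (simp add: complex_eq_iff)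
qed

text \<open>Strict convexity with an explicit defect: the last term measures how far
  \<open>c\<close> and \<open>d\<close> disagree.\<close>

lemma convex_cmod_square:
  "(1 - t) * (cmod c)\<^sup>2 + t * (cmod d)\<^sup>2 =
    (cmod (of_real (1 - t) * c + of_real t * d))\<^sup>2 + t * (1 - t) * (cmod (c - d))\<^sup>2"
  unfolding cmod_power2 by (simp add: power2_eq_square algebra_simps)

text \<open>
  Testing positive definiteness of a character \<open>\<chi>\<close> on the conjugates \<open>s 0, \<dots>, s (n - 1)\<close> of \<open>g\<close>
  with weight 1 and on the identity with weight \<open>- n \<chi>(g)\<close>.
\<close>

lemma (in group) character_sum_conjugates_ge:
  assumes chi: "group_character G \<chi>" and g: "g \<in> carrier G" and h: "\<And>i. h i \<in> carrier G"
  defines "s \<equiv> \<lambda>i. h i \<otimes> g \<otimes> inv (h i)"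
  shows "real n ^ 2 * (cmod (\<chi> g))\<^sup>2 \<le> Re (\<Sum>i<n. \<Sum>j<n. \<chi> (inv (s j) \<otimes> s i))"
proof -
  have pd: "positive_definite G \<chi>" and one: "\<chi> \<one> = 1" using chi by (auto simp: group_character_def)
  have s: "s i \<in> carrier G" for i using g h by (simp add: s_def)
  have chis: "\<chi> (s i) = \<chi> g" for i using chi g h by (simp add: s_def group_character_def)
  then have chii: "\<chi> (inv (s i)) = cnj (\<chi> g)" for i using character_inv[OF chi s] by simp
  define u where "u i = (case i of 0 \<Rightarrow> \<one> | Suc i \<Rightarrow> s i)" for i
  define z where "z i = (case i of 0 \<Rightarrow> - of_nat n * \<chi> g | Suc i \<Rightarrow> 1)" for i
  have "(\<Sum>i\<le>n. \<Sum>j\<le>n. z i * cnj (z j) * \<chi> (inv (u j) \<otimes> u i)) \<in> \<real>\<^sub>\<ge>\<^sub>0"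
    using s by (intro positive_definite_sum_nonneg[OF pd]) (auto simp: u_def split: nat.split)
  \<comment> \<open>The identity paired with itself contributes
    \<open>n\<^sup>2 |\<chi> g|\<^sup>2\<close>, and each of the two families of cross terms
    contributes its negative, so one negative copy survives.\<close>
  also have "(\<Sum>i\<le>n. \<Sum>j\<le>n. z i * cnj (z j) * \<chi> (inv (u j) \<otimes> u i)) =
      (\<Sum>i<n. \<Sum>j<n. \<chi> (inv (s j) \<otimes> s i)) - of_nat n * of_nat n * (\<chi> g * cnj (\<chi> g))"
    unfolding lessThan_Suc_atMost[symmetric] sum.lessThan_Suc_shift
    using s by (simp add: u_def z_def one chis chii sum.distrib sum_subtractf algebra_simps)
  also have "\<chi> g * cnj (\<chi> g) = of_real ((cmod (\<chi> g))\<^sup>2)" by (rule complex_norm_square[symmetric])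
  finally show ?thesis by (simp add: complex_nonneg_Reals_iff power2_eq_square)
qed

text \<open>With \<open>a\<close> the squared modulus of \<open>\<phi> g\<close>, the double sum of
  \<open>\<phi>\<close> is \<open>n\<^sup>2 a + n (1 - a)\<close>. The bounds for
  \<open>\<chi>\<close> and \<open>\<psi>\<close> make it at least
  \<open>n\<^sup>2 (a + \<delta>)\<close> for the convexity defect \<open>\<delta>\<close>, so
  \<open>n \<delta> \<le> 1\<close> for all \<open>n\<close> and the defect vanishes.\<close>

lemma (in group) extreme_character_if_multiplicative:
  assumes phi: "group_character G \<phi>"
    and mult: "\<And>g. g \<in> carrier G \<Longrightarrow> \<exists>h :: nat \<Rightarrow> 'a. (\<forall>i. h i \<in> carrier G) \<and>
      (\<forall>i j. i \<noteq> j \<longrightarrow>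
        \<phi> (inv (h j \<otimes> g \<otimes> inv (h j)) \<otimes> (h i \<otimes> g \<otimes> inv (h i))) = \<phi> g * cnj (\<phi> g))"
  shows "extreme_character G \<phi>"
  unfolding extreme_character_def
proof (intro conjI allI impI ballI)
  fix \<chi> \<psi> and t :: real and g
  assume chi: "group_character G \<chi>" and psi: "group_character G \<psi>" and t: "0 < t" "t < 1"
    and eq: "\<forall>g\<in>carrier G. \<phi> g = of_real (1 - t) * \<chi> g + of_real t * \<psi> g" and g: "g \<in> carrier G"
  obtain h :: "nat \<Rightarrow> 'a" where h: "\<And>i. h i \<in> carrier G"
    and hm: "\<And>i j. i \<noteq> j \<Longrightarrow>
      \<phi> (inv (h j \<otimes> g \<otimes> inv (h j)) \<otimes> (h i \<otimes> g \<otimes> inv (h i))) = \<phi> g * cnj (\<phi> g)"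
    using mult[OF g] by blast
  define s where "s i = h i \<otimes> g \<otimes> inv (h i)" for i
  have s: "s i \<in> carrier G" for i using g h by (simp add: s_def)
  define a where "a = (cmod (\<phi> g))\<^sup>2"
  define \<delta> where "\<delta> = t * (1 - t) * (cmod (\<chi> g - \<psi> g))\<^sup>2"
  have one: "\<phi> \<one> = 1" using phi by (simp add: group_character_def)
  have "real n * \<delta> \<le> 1" for n
  proof (cases "n = 0")
    case False
    \<comment> \<open>The multiplicativity hypothesis covers \<open>i \<noteq> j\<close>; on the
      diagonal the argument is the identity, with value 1.\<close>
    have "\<phi> (inv (s j) \<otimes> s i) = of_real a + of_bool (i = j) * of_real (1 - a)" for i j
      using hm[of i j] one s complex_norm_square[of "\<phi> g"] by (auto simp: s_def a_def l_inv)
    then have "(\<Sum>i<n. \<Sum>j<n. \<phi> (inv (s j) \<otimes> s i)) =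
        (\<Sum>i<n. \<Sum>j<n. of_real a + of_bool (i = j) * of_real (1 - a))"
      by (intro sum.cong refl)
    also have "\<dots> = of_real (real n * real n * a + real n * (1 - a))"
      by (simp add: sum.distrib sum.delta mult_ac distrib_left flip: sum_distrib_right)
    finally have "real n * real n * a + real n * (1 - a) = Re (\<Sum>i<n. \<Sum>j<n. \<phi> (inv (s j) \<otimes> s i))"
      by simp
    also have "(\<Sum>i<n. \<Sum>j<n. \<phi> (inv (s j) \<otimes> s i)) =
        (\<Sum>i<n. \<Sum>j<n. of_real (1 - t) * \<chi> (inv (s j) \<otimes> s i) + of_real t * \<psi> (inv (s j) \<otimes> s i))"
      using eq s by (intro sum.cong refl) simp
    also have "\<dots> = of_real (1 - t) * (\<Sum>i<n. \<Sum>j<n. \<chi> (inv (s j) \<otimes> s i)) +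
        of_real t * (\<Sum>i<n. \<Sum>j<n. \<psi> (inv (s j) \<otimes> s i))"
      by (simp only: sum.distrib sum_distrib_left)
    also have "Re \<dots> = (1 - t) * Re (\<Sum>i<n. \<Sum>j<n. \<chi> (inv (s j) \<otimes> s i)) +
        t * Re (\<Sum>i<n. \<Sum>j<n. \<psi> (inv (s j) \<otimes> s i))"
      by (simp only: plus_complex.simps times_complex.simps Re_complex_of_real Im_complex_of_real mult_zero_left diff_0_right)
    also have "\<dots> \<ge> (1 - t) * (real n ^ 2 * (cmod (\<chi> g))\<^sup>2) + t * (real n ^ 2 * (cmod (\<psi> g))\<^sup>2)"
      unfolding s_def using t
      by (intro add_mono mult_left_mono character_sum_conjugates_ge chi psi g h) auto
    also have "(1 - t) * (real n ^ 2 * (cmod (\<chi> g))\<^sup>2) + t * (real n ^ 2 * (cmod (\<psi> g))\<^sup>2) =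
        real n ^ 2 * ((1 - t) * (cmod (\<chi> g))\<^sup>2 + t * (cmod (\<psi> g))\<^sup>2)"
      by (simp add: algebra_simps)
    also have "\<dots> = real n * real n * (a + \<delta>)"
      unfolding convex_cmod_square a_def \<delta>_def using eq g by (simp add: power2_eq_square)
    finally have "real n * (real n * \<delta>) \<le> real n * (1 - a)" by (simp add: algebra_simps)
    then have "real n * \<delta> \<le> 1 - a" using False by simp
    then show ?thesis using zero_le_power2[of "cmod (\<phi> g)"] unfolding a_def by linarith
  qed simp
  then have "\<not> 0 < \<delta>" using ex_less_of_nat_mult[of \<delta> 1] by (auto simp: not_less[symmetric])
  moreover have "0 < \<delta>" if "\<chi> g \<noteq> \<psi> g" using that t by (simp add: \<delta>_def)
  ultimately show "\<chi> g = \<psi> g" by blast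
qed (rule phi)

section \<open>Concrete operations and passage between the two infinite groups\<close>

lemma carrier_B_inf: "carrier B_inf = (\<Union>n. B_perms n)"
  and carrier_D_inf: "carrier D_inf = (\<Union>n. D_perms n)"
  by (simp_all add: B_inf_def D_inf_def)

lemma carrier_D_inf_subset: "carrier D_inf \<subseteq> carrier B_inf"
  by (auto simp: carrier_B_inf carrier_D_inf D_perms_def)

lemma mult_inf [simp]: "x \<otimes>\<^bsub>B_inf\<^esub> y = x \<circ> y" "x \<otimes>\<^bsub>D_inf\<^esub> y = x \<circ> y"
  and one_inf [simp]: "\<one>\<^bsub>B_inf\<^esub> = id" "\<one>\<^bsub>D_inf\<^esub> = id"
  by (simp_all add: B_inf_def D_inf_def)

lemma inv_B_inf:
  assumes "g \<in> carrier B_inf" shows "inv\<^bsub>B_inf\<^esub> g = inv_into UNIV g"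
proof -
  obtain n where n: "g \<in> B_perms n" using assms by (auto simp: carrier_B_inf)
  then have "g permutes signed_range n" by (simp add: B_perms_iff)
  then show ?thesis
    using assms B_perms_inv[OF n]
    by (intro group.inv_equality[OF group_B_inf]) (auto simp: permutes_inv_o carrier_B_inf)
qed

lemma inv_D_inf:
  assumes "g \<in> carrier D_inf" shows "inv\<^bsub>D_inf\<^esub> g = inv_into UNIV g"
proof -
  obtain n where n: "g \<in> D_perms n" using assms by (auto simp: carrier_D_inf)
  then have "g permutes signed_range n" by (simp add: B_perms_iff D_perms_iff)
  then show ?thesis
    using assms D_perms_inv[OF n]
    by (intro group.inv_equality[OF group_D_inf]) (auto simp: permutes_inv_o carrier_D_inf)
qed

lemma D_length_eq_B_length_carrier: "\<sigma> \<in> carrier D_inf \<Longrightarrow> D_length \<sigma> = B_length \<sigma>"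
  using D_length_eq_B_length by (auto simp: carrier_D_inf)

lemma finite_subset_B_perms:
  assumes "finite S" "S \<subseteq> carrier B_inf" shows "\<exists>n. S \<subseteq> B_perms n"
  using assms
proof (induction S rule: finite_induct)
  case (insert x S)
  then obtain m n where "S \<subseteq> B_perms m" "x \<in> B_perms n" by (auto simp: carrier_B_inf)
  then have "insert x S \<subseteq> B_perms (max m n)"
    using B_perms_mono[of m "max m n"] B_perms_mono[of n "max m n"] by auto
  then show ?case by blast
qed simp

lemma positive_definite_D_inf_iff:
  "positive_definite D_inf (\<lambda>\<sigma>. q ^ D_length \<sigma>) \<longleftrightarrow> positive_definite D_inf (\<lambda>\<sigma>. q ^ B_length \<sigma>)"
proof -
  have "D_length (inv\<^bsub>D_inf\<^esub> x \<otimes>\<^bsub>D_inf\<^esub> y) = B_length (inv\<^bsub>D_inf\<^esub> x \<otimes>\<^bsub>D_inf\<^esub> y)"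
    if "x \<in> carrier D_inf" "y \<in> carrier D_inf" for x y
  proof -
    interpret group D_inf by (rule group_D_inf)
    show ?thesis using that by (intro D_length_eq_B_length_carrier m_closed inv_closed)
  qed
  then show ?thesis unfolding positive_definite_def
    by (intro all_cong1 imp_cong refl arg_cong[where f = "\<lambda>x. x \<in> \<real>\<^sub>\<ge>\<^sub>0"] sum.cong) simp_all
qed

lemma positive_definite_B_inf_imp_D_inf:
  assumes "positive_definite B_inf \<phi>" shows "positive_definite D_inf \<phi>"
  unfolding positive_definite_def
proof (intro allI impI)
  fix k :: nat and z g assume k: "1 \<le> k" and g: "\<forall>i\<in>{1..k}. g i \<in> carrier D_inf"
  then have "(\<Sum>i=1..k. \<Sum>j=1..k. z i * cnj (z j) * \<phi> (inv\<^bsub>B_inf\<^esub> g j \<otimes>\<^bsub>B_inf\<^esub> g i)) \<in> \<real>\<^sub>\<ge>\<^sub>0"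
    using assms carrier_D_inf_subset unfolding positive_definite_def by blast
  also have "(\<Sum>i=1..k. \<Sum>j=1..k. z i * cnj (z j) * \<phi> (inv\<^bsub>B_inf\<^esub> g j \<otimes>\<^bsub>B_inf\<^esub> g i)) =
      (\<Sum>i=1..k. \<Sum>j=1..k. z i * cnj (z j) * \<phi> (inv\<^bsub>D_inf\<^esub> g j \<otimes>\<^bsub>D_inf\<^esub> g i))"
    using g carrier_D_inf_subset by (intro sum.cong refl) (auto simp: inv_B_inf inv_D_inf subset_iff)
  finally show "(\<Sum>i=1..k. \<Sum>j=1..k. z i * cnj (z j) * \<phi> (inv\<^bsub>D_inf\<^esub> g j \<otimes>\<^bsub>D_inf\<^esub> g i)) \<in> \<real>\<^sub>\<ge>\<^sub>0" .
qed

section \<open>Positive definiteness at odd reciprocals and at zero\<close>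

lemma B_perms_comp_inv:
  assumes "g \<in> B_perms n"
  shows "x \<circ> (h \<circ> g) = y \<longleftrightarrow> x \<circ> h = y \<circ> inv_into UNIV g"
proof -
  have "g permutes signed_range n" using assms by (simp add: B_perms_iff)
  from permutes_inv_o[OF this] show ?thesis by (metis comp_assoc comp_id)
qed

text \<open>
  \<open>card (fixed_vectors N n \<sigma>)\<close> is the character of the permutation representation on
  \<open>odd_vectors N n\<close>, so \<open>(2 * N + 1) ^ - B_length\<close> is a multiple of a character on \<open>B_perms n\<close>.
\<close>

lemma positive_definite_power_B_length:
  fixes s :: complex
  assumes s: "s = 1 \<or> s = - 1"
  shows "positive_definite B_inf (\<lambda>\<sigma>. (s / of_nat (2 * N + 1)) ^ B_length \<sigma>)"
  unfolding positive_definite_def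
proof (intro allI impI)
  fix k :: nat and z :: "nat \<Rightarrow> complex" and g
  assume g: "\<forall>i\<in>{1..k}. g i \<in> carrier B_inf"
  then obtain n where "g ` {1..k} \<subseteq> B_perms n" using finite_subset_B_perms[of "g ` {1..k}"] by blast
  then have gn: "g i \<in> B_perms n" if "i \<in> {1..k}" for i using that by blast
  define M where "M = 2 * N + 1"
  \<comment> \<open>For \<open>s = - 1\<close> the extra factor is the determinant, which is
    multiplicative and can be absorbed into the weights.\<close>
  define w where "w i = z i * s ^ B_length (g i)" for i
  let ?V = "odd_vectors N n"
  let ?b = "\<lambda>x i j. of_bool (x \<circ> inv_into UNIV (g i) = x \<circ> inv_into UNIV (g j)) :: complex"
  have "z i * cnj (z j) * (s / of_nat M) ^ B_length (inv\<^bsub>B_inf\<^esub> g j \<otimes>\<^bsub>B_inf\<^esub> g i) =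
      (\<Sum>x\<in>?V. w i * cnj (w j) * ?b x i j) * (1 / of_nat M ^ n)" if ij: "i \<in> {1..k}" "j \<in> {1..k}" for i j
  proof -
    let ?s = "inv_into UNIV (g j) \<circ> g i"
    have sn: "?s \<in> B_perms n" using gn ij by (intro B_perms_comp B_perms_inv)
    have "of_nat (card (fixed_vectors N n ?s) * M ^ B_length ?s) = (of_nat (M ^ n) :: complex)"
      unfolding M_def card_fixed_vectors_B_length[OF sn] ..
    then have 1: "1 / of_nat M ^ B_length ?s = of_nat (card (fixed_vectors N n ?s)) * (1 / of_nat M ^ n :: complex)"
      by (simp add: M_def field_simps del: of_nat_Suc of_nat_add)
    \<comment> \<open>Being fixed by the quotient of two group elements becomes equality of a term
      in \<open>i\<close> alone with a term in \<open>j\<close> alone, the shape that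
      \<open>of_bool_eq_kernel_nonneg\<close> handles.\<close>
    have "fixed_vectors N n ?s = {x \<in> ?V. x \<circ> inv_into UNIV (g i) = x \<circ> inv_into UNIV (g j)}"
      unfolding fixed_vectors_def B_perms_comp_inv[OF gn[OF ij(1)]] by (auto simp: eq_commute)
    then have 2: "of_nat (card (fixed_vectors N n ?s)) = (\<Sum>x\<in>?V. ?b x i j)"
      by (simp add: Int_def flip: sum.inter_filter)
    have 3: "s ^ B_length ?s = s ^ B_length (g i) * cnj (s ^ B_length (g j))"
      using s minus_one_power_B_length_comp[OF B_perms_inv[OF gn[OF ij(2)]] gn[OF ij(1)], where 'a = complex]
        B_length_inv[OF gn[OF ij(2)]] by auto
    have "(s / of_nat M) ^ B_length ?s =
        s ^ B_length (g i) * cnj (s ^ B_length (g j)) * ((\<Sum>x\<in>?V. ?b x i j) * (1 / of_nat M ^ n))"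
      unfolding power_divide 3[symmetric] 2[symmetric] 1[symmetric] by simp
    moreover have "(\<Sum>x\<in>?V. w i * cnj (w j) * ?b x i j) = w i * cnj (w j) * (\<Sum>x\<in>?V. ?b x i j)"
      by (simp only: sum_distrib_left)
    ultimately show ?thesis
      using g ij by (simp add: inv_B_inf w_def mult_ac)
  qed
  then have "(\<Sum>i=1..k. \<Sum>j=1..k. z i * cnj (z j) *
      (s / of_nat M) ^ B_length (inv\<^bsub>B_inf\<^esub> g j \<otimes>\<^bsub>B_inf\<^esub> g i)) =
      (\<Sum>i=1..k. \<Sum>j=1..k. \<Sum>x\<in>?V. w i * cnj (w j) * ?b x i j) * (1 / of_nat M ^ n)"
    unfolding sum_distrib_right by (intro sum.cong refl) (simp add: sum_distrib_right)
  also have "(\<Sum>i=1..k. \<Sum>j=1..k. \<Sum>x\<in>?V. w i * cnj (w j) * ?b x i j) =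
      (\<Sum>i=1..k. \<Sum>x\<in>?V. \<Sum>j=1..k. w i * cnj (w j) * ?b x i j)"
    by (intro sum.cong refl sum.swap)
  also have "\<dots> = (\<Sum>x\<in>?V. \<Sum>i=1..k. \<Sum>j=1..k. w i * cnj (w j) * ?b x i j)"
    by (rule sum.swap)
  finally have eq: "(\<Sum>i=1..k. \<Sum>j=1..k. z i * cnj (z j) *
      (s / of_nat M) ^ B_length (inv\<^bsub>B_inf\<^esub> g j \<otimes>\<^bsub>B_inf\<^esub> g i)) =
      (\<Sum>x\<in>?V. \<Sum>i=1..k. \<Sum>j=1..k. w i * cnj (w j) * ?b x i j) * (1 / of_nat M ^ n)" .
  have "(\<Sum>x\<in>?V. \<Sum>i=1..k. \<Sum>j=1..k. w i * cnj (w j) * ?b x i j) \<in> \<real>\<^sub>\<ge>\<^sub>0"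
    by (intro sum_in_nonneg_Reals of_bool_eq_kernel_nonneg) simp
  moreover have "1 / of_nat M ^ n = complex_of_real (1 / real M ^ n)" by simp
  then have "1 / of_nat M ^ n \<in> (\<real>\<^sub>\<ge>\<^sub>0 :: complex set)"
    by (simp only: nonneg_Reals_of_real_iff) simp
  ultimately show "(\<Sum>i=1..k. \<Sum>j=1..k. z i * cnj (z j) *
      (s / of_nat (2 * N + 1)) ^ B_length (inv\<^bsub>B_inf\<^esub> g j \<otimes>\<^bsub>B_inf\<^esub> g i)) \<in> \<real>\<^sub>\<ge>\<^sub>0"
    unfolding M_def[symmetric] eq by (rule nonneg_Reals_mult_I)
qed

text \<open>By \<open>0 ^ 0 = 1\<close> this function is the indicator of the identity, so the
  kernel is equality of group elements.\<close>

lemma positive_definite_zero_power_B_length: "positive_definite B_inf (\<lambda>\<sigma>. 0 ^ B_length \<sigma>)"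
  unfolding positive_definite_def
proof (intro allI impI)
  fix k :: nat and z :: "nat \<Rightarrow> complex" and g
  assume g: "\<forall>i\<in>{1..k}. g i \<in> carrier B_inf"
  interpret group B_inf by (rule group_B_inf)
  have "(0 :: complex) ^ B_length (inv\<^bsub>B_inf\<^esub> g j \<otimes>\<^bsub>B_inf\<^esub> g i) = of_bool (g i = g j)"
    if "i \<in> {1..k}" "j \<in> {1..k}" for i j
  proof -
    let ?s = "inv\<^bsub>B_inf\<^esub> g j \<otimes>\<^bsub>B_inf\<^esub> g i"
    have gij: "g i \<in> carrier B_inf" "g j \<in> carrier B_inf" using g that by auto
    then have "?s \<in> carrier B_inf" by (intro m_closed inv_closed)
    then have "B_length ?s = 0 \<longleftrightarrow> ?s = \<one>\<^bsub>B_inf\<^esub>"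
      using B_length_eq_0_iff by (auto simp: carrier_B_inf)
    also have "\<dots> \<longleftrightarrow> g i = g j" using gij by (metis inv_equality inv_inv inv_closed l_inv)
    finally show ?thesis by (auto simp: zero_power)
  qed
  then have "(\<Sum>i=1..k. \<Sum>j=1..k. z i * cnj (z j) * 0 ^ B_length (inv\<^bsub>B_inf\<^esub> g j \<otimes>\<^bsub>B_inf\<^esub> g i)) =
      (\<Sum>i=1..k. \<Sum>j=1..k. z i * cnj (z j) * of_bool (g i = g j))"
    by (intro sum.cong refl) (simp only:)
  also have "\<dots> \<in> \<real>\<^sub>\<ge>\<^sub>0" by (intro of_bool_eq_kernel_nonneg) simp
  finally show "(\<Sum>i=1..k. \<Sum>j=1..k. z i * cnj (z j) * 0 ^ B_length (inv\<^bsub>B_inf\<^esub> g j \<otimes>\<^bsub>B_inf\<^esub> g i)) \<in> \<real>\<^sub>\<ge>\<^sub>0" .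
qed

section \<open>The reflection functions on \<open>D_inf\<close>\<close>

text \<open>Conjugation by this element moves the support of a permutation in
  \<open>B_perms m\<close> to the block after \<open>b\<close>. For \<open>m \<le> b\<close> the two
  blocks do not overlap, and as no signs change, the conjugator lies in the group of type D.\<close>

definition block_swap :: "nat \<Rightarrow> nat \<Rightarrow> int \<Rightarrow> int"
  where "block_swap m b k =
    (if 0 < \<bar>k\<bar> \<and> \<bar>k\<bar> \<le> int m then k + sgn k * int b
     else if int b < \<bar>k\<bar> \<and> \<bar>k\<bar> \<le> int b + int m then k - sgn k * int b else k)"

lemma block_swap_invol: "m \<le> b \<Longrightarrow> block_swap m b (block_swap m b k) = k"
  by (cases k "0 :: int" rule: linorder_cases) (auto simp: block_swap_def)

lemma block_swap_in_D_perms: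
  assumes "m \<le> b" shows "block_swap m b \<in> D_perms (b + m)"
proof -
  have "bij (block_swap m b)"
    using block_swap_invol[OF assms] by (intro o_bij[of "block_swap m b"]) (auto simp: fun_eq_iff)
  moreover have "\<forall>k. k \<notin> signed_range (b + m) \<longrightarrow> block_swap m b k = k"
    by (auto simp: block_swap_def signed_range_iff)
  moreover have "block_swap m b (- k) = - block_swap m b k" for k
    by (auto simp: block_swap_def sgn_if)
  ultimately have "block_swap m b \<in> B_perms (b + m)"
    by (auto simp: B_perms_iff permutes_def bij_iff)
  moreover have "{k \<in> {1..int (b + m)}. block_swap m b k < 0} = {}"
    by (auto simp: block_swap_def sgn_if)
  ultimately show ?thesis
    unfolding D_perms_def by (simp only: mem_Collect_eq card.empty dvd_0_right simp_thms)
qed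

lemma block_swap_conj_moved:
  assumes s: "\<sigma> \<in> B_perms m" and mb: "m \<le> b"
    and k: "(block_swap m b \<circ> \<sigma> \<circ> inv_into UNIV (block_swap m b)) k \<noteq> k"
  shows "int b < \<bar>k\<bar> \<and> \<bar>k\<bar> \<le> int b + int m"
proof -
  have "inv_into UNIV (block_swap m b) = block_swap m b"
    using block_swap_invol[OF mb] by (intro inv_unique_comp) (auto simp: fun_eq_iff)
  then have "block_swap m b (\<sigma> (block_swap m b k)) \<noteq> k" using k by simp
  then have "\<sigma> (block_swap m b k) \<noteq> block_swap m b k" using block_swap_invol[OF mb] by metis
  then have "block_swap m b k \<in> signed_range m" using B_perms_outside[OF s] by blast
  then show ?thesis using mb
    by (cases k "0 :: int" rule: linorder_cases) (auto simp: block_swap_def signed_range_iff split: if_splits)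
qed

lemma group_character_power_D_length:
  assumes "positive_definite D_inf (\<lambda>\<sigma>. q ^ D_length \<sigma>)"
  shows "group_character D_inf (\<lambda>\<sigma>. q ^ D_length \<sigma>)"
  unfolding group_character_def
proof (intro conjI ballI)
  interpret group D_inf by (rule group_D_inf)
  fix g h assume gh: "g \<in> carrier D_inf" "h \<in> carrier D_inf"
  then have "{g, h} \<subseteq> carrier B_inf" using carrier_D_inf_subset by blast
  then obtain n where n: "g \<in> B_perms n" "h \<in> B_perms n" using finite_subset_B_perms[of "{g, h}"] by blast
  have "D_length (h \<otimes>\<^bsub>D_inf\<^esub> g \<otimes>\<^bsub>D_inf\<^esub> inv\<^bsub>D_inf\<^esub> h) = D_length g"
    using gh B_length_conj[OF n] D_length_eq_B_length_carrier[OF gh(1)]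
      D_length_eq_B_length_carrier[of "h \<otimes>\<^bsub>D_inf\<^esub> g \<otimes>\<^bsub>D_inf\<^esub> inv\<^bsub>D_inf\<^esub> h"]
    by (simp del: mult_inf) (simp add: inv_D_inf)
  then show "q ^ D_length (h \<otimes>\<^bsub>D_inf\<^esub> g \<otimes>\<^bsub>D_inf\<^esub> inv\<^bsub>D_inf\<^esub> h) = q ^ D_length g" by simp
next
  show "q ^ D_length \<one>\<^bsub>D_inf\<^esub> = 1" using D_length_eq_B_length[OF id_in_D_perms[of 0]] by simp
qed (rule assms)

text \<open>For conjugates of \<open>g\<close> with disjoint supports the lengths add, so the
  quotient of two of them has length twice that of \<open>g\<close>. As \<open>q\<close> is real,
  the value is the squared modulus required by the multiplicativity criterion.\<close>

lemma extreme_character_power_D_length: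
  assumes pd: "positive_definite D_inf (\<lambda>\<sigma>. q ^ D_length \<sigma>)" and q: "q \<in> \<real>"
  shows "extreme_character D_inf (\<lambda>\<sigma>. q ^ D_length \<sigma>)"
proof (rule group.extreme_character_if_multiplicative[OF group_D_inf group_character_power_D_length[OF pd]])
  interpret group D_inf by (rule group_D_inf)
  fix g assume g: "g \<in> carrier D_inf"
  then obtain m where "g \<in> D_perms m" by (auto simp: carrier_D_inf)
  then have gm: "g \<in> B_perms m" by (simp add: D_perms_def)
  \<comment> \<open>Multiples of \<open>m\<close> keep the blocks pairwise disjoint; starting with
    \<open>Suc i\<close> ensures \<open>m \<le> b i\<close>.\<close>
  define b where "b i = m * Suc i" for i
  define h where "h i = block_swap m (b i)" for i
  define s where "s i = h i \<circ> g \<circ> inv_into UNIV (h i)" for i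
  have mb: "m \<le> b i" for i by (simp add: b_def)
  have h: "h i \<in> carrier D_inf" for i using block_swap_in_D_perms[OF mb] by (auto simp: h_def carrier_D_inf)
  have s_eq: "h i \<otimes>\<^bsub>D_inf\<^esub> g \<otimes>\<^bsub>D_inf\<^esub> inv\<^bsub>D_inf\<^esub> (h i) = s i" for i
    by (simp add: s_def inv_D_inf[OF h])
  have sc: "s i \<in> carrier D_inf" for i unfolding s_eq[symmetric] by (intro m_closed inv_closed g h)
  have "D_length (inv\<^bsub>D_inf\<^esub> (s j) \<otimes>\<^bsub>D_inf\<^esub> s i) = D_length g + D_length g" if "i \<noteq> j" for i j
  proof -
    have "{g, h i, h j, s i, s j} \<subseteq> carrier B_inf" using g h sc carrier_D_inf_subset by blast
    then obtain n where "{g, h i, h j, s i, s j} \<subseteq> B_perms n"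
      using finite_subset_B_perms[of "{g, h i, h j, s i, s j}"] by blast
    then have n: "g \<in> B_perms n" "h i \<in> B_perms n" "h j \<in> B_perms n" "s i \<in> B_perms n" "s j \<in> B_perms n"
      by simp_all
    have "inv_into UNIV (s j) k = k \<or> s i k = k" for k
    proof (rule ccontr)
      assume "\<not> ?thesis"
      then have "s j k \<noteq> k" "s i k \<noteq> k"
        using n(5) by (auto simp: B_perms_iff permutes_inv_eq)
      then have "int (b j) < \<bar>k\<bar>" "\<bar>k\<bar> \<le> int (b j) + int m" "int (b i) < \<bar>k\<bar>" "\<bar>k\<bar> \<le> int (b i) + int m"
        using block_swap_conj_moved[OF gm mb] by (auto simp: s_def h_def)
      moreover have "b i' + m \<le> b j'" if "i' < j'" for i' j'
      proof -
        have "m * (Suc i' + 1) \<le> m * Suc j'" using that by (intro mult_le_mono) auto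
        then show ?thesis by (simp add: b_def)
      qed
      ultimately show False using \<open>i \<noteq> j\<close> by (cases i j rule: linorder_cases) force+
    qed
    then have "B_length (inv_into UNIV (s j) \<circ> s i) = B_length (inv_into UNIV (s j)) + B_length (s i)"
      using n by (intro B_length_disjoint B_perms_inv)
    also have "\<dots> = B_length g + B_length g"
      unfolding B_length_inv[OF n(5)] unfolding s_def B_length_conj[OF n(1,2)] B_length_conj[OF n(1,3)] ..
    finally have "B_length (inv\<^bsub>D_inf\<^esub> (s j) \<otimes>\<^bsub>D_inf\<^esub> s i) = B_length g + B_length g"
      by (simp add: inv_D_inf[OF sc])
    then show ?thesis using g sc by (metis D_length_eq_B_length_carrier m_closed inv_closed)
  qed
  then have "q ^ D_length (inv\<^bsub>D_inf\<^esub> (s j) \<otimes>\<^bsub>D_inf\<^esub> s i) = q ^ D_length g * cnj (q ^ D_length g)"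
    if "i \<noteq> j" for i j
    using that q by (simp add: power_add Reals_cnj_iff)
  then show "\<exists>h :: nat \<Rightarrow> int \<Rightarrow> int. (\<forall>i. h i \<in> carrier D_inf) \<and> (\<forall>i j. i \<noteq> j \<longrightarrow>
      q ^ D_length (inv\<^bsub>D_inf\<^esub> (h j \<otimes>\<^bsub>D_inf\<^esub> g \<otimes>\<^bsub>D_inf\<^esub> inv\<^bsub>D_inf\<^esub> (h j)) \<otimes>\<^bsub>D_inf\<^esub>
        (h i \<otimes>\<^bsub>D_inf\<^esub> g \<otimes>\<^bsub>D_inf\<^esub> inv\<^bsub>D_inf\<^esub> (h i))) = q ^ D_length g * cnj (q ^ D_length g))"
    using h s_eq by (intro exI[of _ h]) metis
qed

section \<open>Necessity of the condition on \<open>q\<close>\<close>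

lemma positive_definite_power_real_bound:
  assumes pd: "positive_definite D_inf (\<lambda>\<sigma>. q ^ B_length \<sigma>)"
  obtains r :: real where "q = of_real r" "\<bar>r\<bar> \<le> 1"
proof -
  let ?r = "signed_swap 1 2"
  have rng: "1 \<in> signed_range 2" "2 \<in> signed_range 2" by (auto simp: signed_range_iff)
  then have "?r \<in> D_refl 2"
    unfolding D_refl_eq mem_Collect_eq by - (rule exI[of _ 1], rule exI[of _ 2], simp)
  then have r: "?r \<in> carrier D_inf" using D_refl_subset by (auto simp: carrier_D_inf)
  have id: "id \<in> carrier D_inf" using id_in_D_perms by (auto simp: carrier_D_inf)
  have len: "B_length ?r = 1"
    using B_length_signed_swap[OF id_in_B_perms[of 2] rng] by simp
  have rr: "?r \<circ> ?r = id" by (auto simp: fun_eq_iff)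
  then have "inv_into UNIV ?r = ?r" by (intro inv_unique_comp)
  then have inv: "inv\<^bsub>D_inf\<^esub> ?r = ?r" "inv\<^bsub>D_inf\<^esub> id = id"
    using inv_D_inf[OF r] inv_D_inf[OF id] by simp_all
  \<comment> \<open>The test on the identity and one reflection with weights 1 and \<open>c\<close>;
    the two signs of \<open>c\<close> give both reality and the bound.\<close>
  have *: "2 + 2 * c * q \<in> \<real>\<^sub>\<ge>\<^sub>0" if "c = 1 \<or> c = - 1" for c :: complex
  proof -
    have "(\<Sum>i\<in>{False, True}. \<Sum>j\<in>{False, True}. (if i then c else 1) * cnj (if j then c else 1) *
        q ^ B_length (inv\<^bsub>D_inf\<^esub> (if j then ?r else id) \<otimes>\<^bsub>D_inf\<^esub> (if i then ?r else id))) \<in> \<real>\<^sub>\<ge>\<^sub>0"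
      using r id by (intro positive_definite_sum_nonneg[OF pd]) auto
    then show ?thesis using that by (auto simp: inv rr len add.commute)
  qed
  have "q = of_real (Re q)" "\<bar>Re q\<bar> \<le> 1"
    using *[of 1] *[of "- 1"] by (auto simp: complex_nonneg_Reals_iff complex_eq_iff)
  then show ?thesis by (rule that)
qed

text \<open>The weights form the trivial character or the determinant. Being multiplicative, they
  merge with the powers of \<open>r\<close>, and left translation makes all inner sums
  equal.\<close>

lemma sum_power_D_perms_nonneg:
  fixes r s :: real
  assumes pd: "positive_definite D_inf (\<lambda>\<sigma>. (of_real r :: complex) ^ B_length \<sigma>)" and s: "s = 1 \<or> s = - 1"
  shows "0 \<le> (\<Sum>\<sigma>\<in>D_perms n. (s * r) ^ B_length \<sigma>)"
proof -
  let ?D = "D_perms n"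
  let ?z = "\<lambda>g. of_real s ^ B_length g :: complex"
  let ?S = "\<Sum>\<sigma>\<in>?D. (s * r) ^ B_length \<sigma>"
  have fin: "finite ?D" by (rule finite_subset[OF _ finite_B_perms[of n]]) (auto simp: D_perms_def)
  have B: "g \<in> B_perms n" if "g \<in> ?D" for g using that by (simp add: D_perms_def)
  have C: "g \<in> carrier D_inf" if "g \<in> ?D" for g using that by (auto simp: carrier_D_inf)
  have "(\<Sum>g\<in>?D. \<Sum>h\<in>?D. ?z g * cnj (?z h) * of_real r ^ B_length (inv\<^bsub>D_inf\<^esub> h \<otimes>\<^bsub>D_inf\<^esub> g)) \<in> \<real>\<^sub>\<ge>\<^sub>0"
    using C by (intro positive_definite_sum_nonneg[OF pd fin]) auto
  also have "(\<Sum>g\<in>?D. \<Sum>h\<in>?D. ?z g * cnj (?z h) * of_real r ^ B_length (inv\<^bsub>D_inf\<^esub> h \<otimes>\<^bsub>D_inf\<^esub> g)) =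
      (\<Sum>g\<in>?D. \<Sum>h\<in>?D. of_real ((s * r) ^ B_length (inv_into UNIV h \<circ> g)))"
  proof (intro sum.cong refl)
    fix g h assume gh: "g \<in> ?D" "h \<in> ?D"
    have "(- 1) ^ B_length (inv_into UNIV h \<circ> g) = (- 1) ^ B_length g * ((- 1) ^ B_length h :: complex)"
      using minus_one_power_B_length_comp[OF B_perms_inv[OF B[OF gh(2)]] B[OF gh(1)], where 'a = complex]
        B_length_inv[OF B[OF gh(2)]] by simp
    then have "complex_of_real s ^ B_length (inv_into UNIV h \<circ> g) = ?z g * cnj (?z h)"
      using s by auto
    then show "?z g * cnj (?z h) * of_real r ^ B_length (inv\<^bsub>D_inf\<^esub> h \<otimes>\<^bsub>D_inf\<^esub> g) =
        of_real ((s * r) ^ B_length (inv_into UNIV h \<circ> g))"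
      using gh by (simp add: inv_D_inf[OF C] power_mult_distrib)
  qed
  also have "\<dots> = of_real (\<Sum>h\<in>?D. \<Sum>g\<in>?D. (s * r) ^ B_length (inv_into UNIV h \<circ> g))"
    by (subst sum.swap) simp
  also have "(\<Sum>h\<in>?D. \<Sum>g\<in>?D. (s * r) ^ B_length (inv_into UNIV h \<circ> g)) = (\<Sum>h\<in>?D. ?S)"
  proof (rule sum.cong[OF refl])
    fix h assume h: "h \<in> ?D"
    have p: "h permutes signed_range n" using B[OF h] by (simp add: B_perms_iff)
    have "bij_betw (\<lambda>g. inv_into UNIV h \<circ> g) ?D ?D"
      using h by (intro bij_betw_byWitness[where f' = "\<lambda>g. h \<circ> g"])
        (auto simp: o_assoc permutes_inv_o[OF p] intro: D_perms_comp D_perms_inv)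
    then show "(\<Sum>g\<in>?D. (s * r) ^ B_length (inv_into UNIV h \<circ> g)) = ?S"
      by (rule sum.reindex_bij_betw)
  qed
  also have "\<dots> = real (card ?D) * ?S" by simp
  finally have "0 \<le> real (card ?D) * ?S" unfolding nonneg_Reals_of_real_iff .
  moreover have "0 < card ?D" using fin id_in_D_perms[of n] by (auto simp: card_gt_0_iff)
  ultimately show ?thesis by (simp add: zero_le_mult_iff)
qed

text \<open>
  If \<open>1 / r\<close> lies strictly between \<open>2 * N + 1\<close> and \<open>2 * N + 3\<close>, then for \<open>m = N + 2\<close> only the factor
  with \<open>k = N + 1\<close> is negative, provided that \<open>N > 0\<close>; for \<open>N = 0\<close> take \<open>m = 3\<close>, where
  \<open>1 - 3 * r\<close> occurs twice.
\<close>

lemma odd_reciprocal_if_products_nonneg: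
  fixes r :: real
  assumes r: "0 \<le> r" "r \<le> 1"
    and nonneg: "\<And>m. 0 \<le> (\<Prod>k<m. 1 - (2 * real k + 1) * r) * (1 - real m * r)"
  shows "r = 0 \<or> (\<exists>N::nat. r = 1 / (2 * real N + 1))"
proof (rule disjCI)
  assume nex: "\<nexists>N::nat. r = 1 / (2 * real N + 1)"
  show "r = 0"
  proof (rule ccontr)
    assume "r \<noteq> 0"
    then have r0: "r > 0" using r by simp
    \<comment> \<open>Chosen so that \<open>1 / r\<close> lies in the half-open interval from
      \<open>2 * N + 1\<close> to \<open>2 * N + 3\<close>.\<close>
    define N where "N = nat \<lfloor>(1 / r - 1) / 2\<rfloor>"
    define x where "x = 1 / r"
    have "1 \<le> x" using r r0 by (simp add: x_def)
    then have "real N = real_of_int \<lfloor>(x - 1) / 2\<rfloor>" by (simp add: N_def x_def)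
    then have N: "real N \<le> (x - 1) / 2" "(x - 1) / 2 < real N + 1"
      using floor_correct[of "(x - 1) / 2"] by simp_all
    have "2 * real N + 1 \<le> x" using N(1) by simp
    moreover have "x < 2 * real N + 3" using N(2) by simp
    ultimately have le: "(2 * real N + 1) * r \<le> 1" and gt: "1 < (2 * real N + 3) * r"
      using r0 by (simp_all add: x_def field_simps)
    have "(2 * real N + 1) * r \<noteq> 1" using nex r0 by (auto simp: field_simps)
    then have lt: "(2 * real N + 1) * r < 1" using le by simp
    show False
    proof (cases "N = 0")
      case True
      then have r13: "1 / 3 < r" "r < 1" using lt gt by auto
      have "0 \<le> (\<Prod>k<3. 1 - (2 * real k + 1) * r) * (1 - real 3 * r)" by (rule nonneg)
      then have "0 \<le> (1 - r) * (1 - 5 * r) * (1 - 3 * r)\<^sup>2"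
        by (simp add: eval_nat_numeral algebra_simps)
      moreover have "(1 - r) * (1 - 5 * r) < 0" using r13 by (intro mult_pos_neg) auto
      then have "(1 - r) * (1 - 5 * r) * (1 - 3 * r)\<^sup>2 < 0" by (rule mult_neg_pos) (use r13 in simp)
      ultimately show False by simp
    next
      case False
      have "0 < 1 - (2 * real k + 1) * r" if "k < Suc N" for k
      proof -
        have "(2 * real k + 1) * r \<le> (2 * real N + 1) * r" using that r0 by (intro mult_right_mono) auto
        then show ?thesis using lt by simp
      qed
      then have "0 < (\<Prod>k<Suc N. 1 - (2 * real k + 1) * r)" by (intro prod_pos) auto
      moreover have "1 - (2 * real (Suc N) + 1) * r < 0" using gt by (simp add: algebra_simps)
      ultimately have "(\<Prod>k<Suc (Suc N). 1 - (2 * real k + 1) * r) < 0"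
        unfolding prod.lessThan_Suc[of _ "Suc N"] by (rule mult_pos_neg)
      moreover have "0 < 1 - real (Suc (Suc N)) * r"
      proof -
        \<comment> \<open>This uses \<open>N + 2 \<le> 2 * N + 1\<close>, which is where
          \<open>N > 0\<close> is needed.\<close>
        have "real (Suc (Suc N)) * r \<le> (2 * real N + 1) * r" using False r0 by (intro mult_right_mono) auto
        then show ?thesis using lt by simp
      qed
      ultimately have "(\<Prod>k<Suc (Suc N). 1 - (2 * real k + 1) * r) * (1 - real (Suc (Suc N)) * r) < 0"
        by (rule mult_neg_pos)
      then show False using nonneg[of "Suc (Suc N)"] by simp
    qed
  qed
qed

lemma odd_reciprocal_if_positive_definite:
  assumes pd: "positive_definite D_inf (\<lambda>\<sigma>. q ^ B_length \<sigma>)"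
  shows "q \<in> {1 / (2 * of_int N + 1) | N :: int. True} \<union> {0}"
proof -
  obtain r where r: "q = of_real r" "\<bar>r\<bar> \<le> 1" using positive_definite_power_real_bound[OF pd] .
  \<comment> \<open>The determinant twist is used exactly when \<open>r\<close> is nonnegative, so
    that the generating function is evaluated at \<open>- \<bar>r\<bar>\<close>.\<close>
  define s :: real where "s = (if 0 \<le> r then - 1 else 1)"
  have sr: "s * r = - \<bar>r\<bar>" by (simp add: s_def)
  have "0 \<le> (\<Prod>k<m. 1 - (2 * real k + 1) * \<bar>r\<bar>) * (1 - real m * \<bar>r\<bar>)" for m
    using sum_power_D_perms_nonneg[OF pd[unfolded r], of s "Suc m"]
    unfolding sr sum_power_B_length_D_perms by (simp add: s_def)
  from odd_reciprocal_if_products_nonneg[OF _ r(2) this]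
  consider "r = 0" | N :: nat where "\<bar>r\<bar> = 1 / (2 * real N + 1)" by auto
  then show ?thesis
  proof cases
    case (2 N)
    \<comment> \<open>Negative odd denominators correspond to the index
      \<open>- N - 1\<close>.\<close>
    have "2 * real_of_int (- int N - 1) + 1 = - (2 * real N + 1)" by simp
    then have "r = 1 / (2 * real_of_int (- int N - 1) + 1)" if "r < 0"
      using 2 that by (simp only: divide_minus_right)
    moreover have "r = 1 / (2 * real_of_int (int N) + 1)" if "\<not> r < 0"
      using 2 that by simp
    ultimately obtain M :: int where "r = 1 / (2 * real_of_int M + 1)" by blast
    then have "q = 1 / (2 * of_int M + 1)" unfolding r(1) by simp
    then show ?thesis by blast
  qed (simp add: r)
qed

lemma positive_definite_if_odd_reciprocal:
  assumes "q \<in> {1 / (2 * of_int N + 1) | N :: int. True} \<union> {0}"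
  shows "positive_definite B_inf (\<lambda>\<sigma>. q ^ B_length \<sigma>)"
proof -
  consider "q = 0" | N :: int where "q = 1 / (2 * of_int N + 1)" using assms by auto
  then show ?thesis
  proof cases
    case 1
    then show ?thesis using positive_definite_zero_power_B_length by simp
  next
    case (2 N)
    show ?thesis
    proof (cases "0 \<le> N")
      case True
      then have "q = 1 / of_nat (2 * nat N + 1)" using 2 by simp
      then show ?thesis using positive_definite_power_B_length[of 1 "nat N"] by simp
    next
      case False
      define K where "K = nat (- N - 1)"
      have "N = - int K - 1" using False by (simp add: K_def)
      then have "2 * of_int N + 1 = (- of_nat (2 * K + 1) :: complex)" by simp
      then have "q = - 1 / of_nat (2 * K + 1)" using 2 by (simp only: divide_minus_right) simp
      then show ?thesis using positive_definite_power_B_length[of "- 1" K] by (simp only:) simp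
    qed
  qed
qed

theorem theoremA1:
  fixes q :: complex
  shows "(positive_definite D_inf (\<lambda>\<sigma>. q ^ D_length \<sigma>) \<longleftrightarrow>
          group_character D_inf (\<lambda>\<sigma>. q ^ D_length \<sigma>)) \<and>
         (group_character D_inf (\<lambda>\<sigma>. q ^ D_length \<sigma>) \<longleftrightarrow>
          extreme_character D_inf (\<lambda>\<sigma>. q ^ D_length \<sigma>)) \<and>
         (extreme_character D_inf (\<lambda>\<sigma>. q ^ D_length \<sigma>) \<longleftrightarrow>
          positive_definite B_inf (\<lambda>\<sigma>. q ^ B_length \<sigma>) \<and>
            (\<forall>\<sigma>\<in>carrier D_inf. q ^ D_length \<sigma> = q ^ B_length \<sigma>)) \<and>
         (positive_definite B_inf (\<lambda>\<sigma>. q ^ B_length \<sigma>) \<and>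
            (\<forall>\<sigma>\<in>carrier D_inf. q ^ D_length \<sigma> = q ^ B_length \<sigma>) \<longleftrightarrow>
          q \<in> {1 / (2 * of_int N + 1) | N :: int. True} \<union> {0})"
proof -
  let ?D = "positive_definite D_inf (\<lambda>\<sigma>. q ^ D_length \<sigma>)"
  let ?B = "positive_definite B_inf (\<lambda>\<sigma>. q ^ B_length \<sigma>)"
  let ?Q = "q \<in> {1 / (2 * of_int N + 1) | N :: int. True} \<union> {0}"
  have eq: "\<forall>\<sigma>\<in>carrier D_inf. q ^ D_length \<sigma> = q ^ B_length \<sigma>"
    by (simp add: D_length_eq_B_length_carrier)
  \<comment> \<open>The implications close up in a cycle: type D positivity forces the arithmetic
    condition, which gives type B positivity, which restricts to type D.\<close>
  have DQ: "?Q" if ?D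
    using that odd_reciprocal_if_positive_definite by (simp only: positive_definite_D_inf_iff)
  have QB: ?B if ?Q using positive_definite_if_odd_reciprocal that by blast
  have BD: ?D if ?B
    using positive_definite_B_inf_imp_D_inf[OF that] by (simp only: positive_definite_D_inf_iff)
  have ext: "extreme_character D_inf (\<lambda>\<sigma>. q ^ D_length \<sigma>)" if ?D
  proof (rule extreme_character_power_D_length[OF that])
    from that have "positive_definite D_inf (\<lambda>\<sigma>. q ^ B_length \<sigma>)"
      by (simp only: positive_definite_D_inf_iff)
    then obtain r :: real where "q = of_real r" by (rule positive_definite_power_real_bound)
    then show "q \<in> \<real>" by simp
  qed
  have "extreme_character D_inf (\<lambda>\<sigma>. q ^ D_length \<sigma>) \<Longrightarrow> group_character D_inf (\<lambda>\<sigma>. q ^ D_length \<sigma>)"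
    "group_character D_inf (\<lambda>\<sigma>. q ^ D_length \<sigma>) \<Longrightarrow> ?D"
    by (simp_all add: extreme_character_def group_character_def)
  then show ?thesis using eq DQ QB BD ext by blast
qed

end
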